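(* For every integer $k\ge 2$ there is a constant $C_k$ depending only on $k$ such that for every $k$-uniform hypergraph $\mathcal{H}$ on $n$ vertices with degree sequence $d_1,\dots,d_n$ and every $\alpha\in[0,1]$, with $\phi(s)=(k-1)^{n-1}\alpha^{s}\sum_{i=1}^{n}d_i^{s}$: (1) $\mathrm{Tr}_d(\mathcal{A}_\alpha(\mathcal{H}))=\phi(d)$ for $d=1,\dots,k-1$; (2) $\mathrm{Tr}_k(\mathcal{A}_\alpha(\mathcal{H}))=\phi(k)+(k-1)^{n-k}k^{k-1}(1-\alpha)^k|E(\mathcal{H})|$; (3) $\mathrm{Tr}_{k+1}(\mathcal{A}_\alpha(\mathcal{H}))=\phi(k+1)+(k+1)(k-1)^{n-k}\Big(k^{k-2}\alpha(1-\alpha)^k\sum_{i=1}^n d_i^2+(1-\alpha)^{k+1}C_k|\mathcal{K}_{k+1}|\Big)$, where $\mathcal{K}_{k+1}$ is the set of all complete $k$-uniform subhypergraphs of $\mathcal{H}$ with $k+1$ hyperedges (that is, on $k+1$ vertices).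
   Context: For a $k$-uniform hypergraph $\mathcal{H}$ on $[n]$ (every hyperedge has exactly $k$ vertices), the adjacency tensor $\mathcal{A}(\mathcal{H})$ is the $k$-order $n$-dimensional tensor with entry $\frac{1}{(k-1)!}$ at $(i_1,\dots,i_k)$ if $\{i_1,\dots,i_k\}\in E(\mathcal{H})$ and $0$ otherwise; $\mathcal{D}(\mathcal{H})$ is the diagonal tensor with $(i,\dots,i)$-entry the degree $d_i$ of $i$; and $\mathcal{A}_\alpha(\mathcal{H})=\alpha\mathcal{D}(\mathcal{H})+(1-\alpha)\mathcal{A}(\mathcal{H})$. For a $k$-order $n$-dimensional tensor $\mathcal{T}$ and $d\ge 1$, $$\mathrm{Tr}_{d}(\mathcal{T})=(k-1)^{n-1}\sum_{d_1+\cdots+d_n=d}\ \prod_{i=1}^{n}\frac{1}{(d_i(k-1))!}\Big(\sum_{\gamma\in[n]^{k-1}}(\mathcal{T})_{i\gamma}\frac{\partial}{\partial a_{i\gamma}}\Big)^{d_i}\mathrm{tr}\big(A^{d(k-1)}\big),$$ where $A=(a_{ij})$ is an $n\times n$ matrix of indeterminates, the $d_i$ in this formula are nonnegative integers, and $\frac{\partial}{\partial a_{i\gamma}}=\frac{\partial}{\partial a_{i i_2}}\cdots\frac{\partial}{\partial a_{i i_k}}$ for $\gamma=i_2\cdots i_k$. It equals the sum of the $d$-th powers of all $n(k-1)^{n-1}$ eigenvalues of $\mathcal{T}$ (roots of its characteristic polynomial, with multiplicity). *)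

theory Defs
  imports Complex_Main "HOL-Library.Poly_Mapping" "Jordan_Normal_Form.Matrix"
begin

text \<open>
  The vertex set $[n]$ is represented by the set of natural numbers below \<open>n\<close>, matching the
  zero-based row and column indices of matrices. A hypergraph on it is given by its edge set.
\<close>

definition uniform_hypergraph :: "nat \<Rightarrow> nat \<Rightarrow> nat set set \<Rightarrow> bool" where
  "uniform_hypergraph k n E \<longleftrightarrow> (\<forall>e\<in>E. e \<subseteq> {..<n} \<and> card e = k)"

definition vertex_degree :: "nat set set \<Rightarrow> nat \<Rightarrow> nat" where
  "vertex_degree E i = card {e \<in> E. i \<in> e}"

text \<open>A subhypergraph is a pair of a vertex set and an edge set.\<close>

definition complete_subhypergraphs ::
    "nat \<Rightarrow> nat \<Rightarrow> nat set set \<Rightarrow> (nat set \<times> nat set set) set" where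
  "complete_subhypergraphs k n E =
     {(V', E'). V' \<subseteq> {..<n} \<and> E' \<subseteq> E \<and> E' = {e. e \<subseteq> V' \<and> card e = k}}"

definition complete_subhypergraphs_Suc ::
    "nat \<Rightarrow> nat \<Rightarrow> nat set set \<Rightarrow> (nat set \<times> nat set set) set" where
  "complete_subhypergraphs_Suc k n E =
     {(V', E') \<in> complete_subhypergraphs k n E. card E' = k + 1}"

text \<open>
  A tensor of order \<open>k\<close> and dimension \<open>n\<close> is a function on index lists; only its values on
  lists of length \<open>k\<close> with entries below \<open>n\<close> are relevant.
\<close>

type_synonym tensor = "nat list \<Rightarrow> real"

definition adjacency_tensor :: "nat \<Rightarrow> nat set set \<Rightarrow> tensor" where
  "adjacency_tensor k E is = (if set is \<in> E then 1 / fact (k - 1) else 0)"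

definition degree_tensor :: "nat \<Rightarrow> nat set set \<Rightarrow> tensor" where
  "degree_tensor k E is =
     (if is = replicate k (hd is) then real (vertex_degree E (hd is)) else 0)"

definition A_alpha_tensor :: "nat \<Rightarrow> nat set set \<Rightarrow> real \<Rightarrow> tensor" where
  "A_alpha_tensor k E \<alpha> is =
     \<alpha> * degree_tensor k E is + (1 - \<alpha>) * adjacency_tensor k E is"

text \<open>
  Real polynomials in the indeterminates $a_{ij}$: a monomial maps the index pair \<open>(i, j)\<close> to
  the exponent of $a_{ij}$, and a polynomial maps monomials to coefficients. Multiplication of
  the outer type is convolution, so this is the usual polynomial ring.
\<close>

type_synonym entry_poly = "((nat \<times> nat) \<Rightarrow>\<^sub>0 nat) \<Rightarrow>\<^sub>0 real"

definition indet :: "nat \<times> nat \<Rightarrow> entry_poly" where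
  "indet v = Poly_Mapping.single (Poly_Mapping.single v 1) 1"

definition scalar_poly :: "real \<Rightarrow> entry_poly" where
  "scalar_poly c = Poly_Mapping.single 0 c"

text \<open>
  Monomials not containing \<open>v\<close> contribute a zero coefficient, so the truncated subtraction of
  exponents is harmless.
\<close>

definition partial_deriv :: "nat \<times> nat \<Rightarrow> entry_poly \<Rightarrow> entry_poly" where
  "partial_deriv v p =
     (\<Sum>m\<in>Poly_Mapping.keys p.
        Poly_Mapping.single (m - Poly_Mapping.single v 1)
          (real (Poly_Mapping.lookup m v) * Poly_Mapping.lookup p m))"

definition generic_matrix :: "nat \<Rightarrow> entry_poly mat" where
  "generic_matrix n = mat n n indet"

definition mat_trace :: "'a::comm_monoid_add mat \<Rightarrow> 'a" where
  "mat_trace A = (\<Sum>i<dim_row A. A $$ (i, i))"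

text \<open>
  The operator $\sum_{\gamma \in [n]^{k-1}} T_{i\gamma}\, \partial/\partial a_{i\gamma}$.
\<close>

definition row_operator :: "nat \<Rightarrow> nat \<Rightarrow> tensor \<Rightarrow> nat \<Rightarrow> entry_poly \<Rightarrow> entry_poly" where
  "row_operator k n T i p =
     (\<Sum>\<gamma> | length \<gamma> = k - 1 \<and> set \<gamma> \<subseteq> {..<n}.
        scalar_poly (T (i # \<gamma>)) * foldr (\<lambda>j. partial_deriv (i, j)) \<gamma> p)"

text \<open>
  The product over \<open>i\<close> of the scaled powers of the row operators, in the sense of composition;
  these operators commute.
\<close>

definition operator_product ::
    "nat \<Rightarrow> nat \<Rightarrow> tensor \<Rightarrow> nat list \<Rightarrow> entry_poly \<Rightarrow> entry_poly" where
  "operator_product k n T ds =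
     foldr (\<lambda>i p. scalar_poly (1 / fact (ds ! i * (k - 1))) * (row_operator k n T i ^^ (ds ! i)) p)
       [0..<n]"

text \<open>
  The $d$-th order trace. The operators have total order \<open>d * (k - 1)\<close>, which is the degree of the
  homogeneous polynomial they are applied to; hence the resulting polynomial is constant, and
  it is identified with its coefficient at the trivial monomial.
\<close>

definition tensor_trace :: "nat \<Rightarrow> nat \<Rightarrow> nat \<Rightarrow> tensor \<Rightarrow> real" where
  "tensor_trace k n d T =
     (real k - 1) ^ (n - 1) *
     Poly_Mapping.lookup
       (\<Sum>ds | length ds = n \<and> sum_list ds = d.
          operator_product k n T ds (mat_trace (generic_matrix n ^\<^sub>m (d * (k - 1))))) 0"

end

theory Submission
  imports Defs "Jordan_Normal_Form.Determinant" "HOL-Combinatorics.Multiset_Permutations"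
begin

text \<open>
  Expanding the differential operators, a term of the trace selects \<open>d\<close> pairs consisting of a vertex
  \<open>i\<close> and either the loop at \<open>i\<close> or an edge containing \<open>i\<close>. The selected pairs span a multidigraph
  with \<open>d (k - 1)\<close> arcs, and the term is, up to weights and factorials, its number of closed Eulerian
  trails. Such trails exist only if the multidigraph is connected and balanced. If an edge is
  selected, then every vertex of that edge has to be selected too, so \<open>d \<ge> k\<close>; for \<open>d \<le> k + 1\<close>
  the only possibilities are: loops at a single vertex; a complete digraph on an edge (\<open>d = k\<close>); the
  same together with a loop selected at one of its vertices (\<open>d = k + 1\<close>); or \<open>k + 1\<close> vertices each of
  which selects an edge omitting one other vertex, the omitted vertices forming a derangement
  (\<open>d = k + 1\<close>), which requires a complete subhypergraph. The trails are counted by the BEST theorem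
  and Cayley's formula in the first three cases; in the last case only the independence of the
  hypergraph matters.
\<close>

section \<open>Determinants of matrices given by their entries\<close>

text \<open>Derivatives and trails are linked by a rescaling: multiplying each coefficient of a
  polynomial by the factorials of its exponents turns derivatives into shifts and, on a power of the
  generic matrix, makes parallel arcs distinguishable. Coefficients and trail counts then obey the
  same recursion removing the first arc, so no explicit correspondence between terms and trails is
  needed. In the BEST theorem, summing over the start of a closed trail gives the factor d (k - 1),
  and the vertex factorials cancel against those of the operators up to 1 / (l (k - 1)) at a vertex
  with l choices. A support of k vertices therefore yields (k - 1) / (k - 1)^k, which turns (k -
  1)^(n - 1) into (k - 1)^(n - k), while Cayley's k^(k - 2) supplies the powers of k. The clique
  count is left unevaluated: a bijection onto {0, ..., k} shows that it depends only on k, which is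
  all that C_k requires.\<close>

definition fdet :: "nat \<Rightarrow> (nat \<Rightarrow> nat \<Rightarrow> real) \<Rightarrow> real" where
  "fdet n R = det (mat n n (\<lambda>(i, j). R i j))"

lemma fdet_leibniz:
  "fdet n R = (\<Sum>p | p permutes {0..<n}. signof p * (\<Prod>i = 0..<n. R i (p i)))"
proof -
  have "(\<Prod>i = 0..<n. mat n n (\<lambda>(i, j). R i j) $$ (i, p i)) = (\<Prod>i = 0..<n. R i (p i))"
    if "p permutes {0..<n}" for p
  proof (rule prod.cong[OF refl])
    fix i assume "i \<in> {0..<n}"
    then have "p i < n" using permutes_in_image[OF that, of i] by auto
    then show "mat n n (\<lambda>(i, j). R i j) $$ (i, p i) = R i (p i)"
      using \<open>i \<in> {0..<n}\<close> by auto
  qed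
  then show ?thesis
    unfolding fdet_def det_def by (auto intro!: sum.cong)
qed

lemma fdet_cong:
  assumes "\<And>i j. i < n \<Longrightarrow> j < n \<Longrightarrow> R i j = R' i j"
  shows "fdet n R = fdet n R'"
  unfolding fdet_def using assms by (auto intro!: arg_cong[where f = det])

text \<open>Each Leibniz summand has exactly one factor from row \<open>u\<close>. With entries
  given by a function, replacing a row is a function update.\<close>

lemma fdet_row_linear:
  assumes u: "u < n"
    and R: "\<And>j. j < n \<Longrightarrow> R u j = (\<Sum>x\<in>X. c x * r x j)"
  shows "fdet n R = (\<Sum>x\<in>X. c x * fdet n (R(u := r x)))"
proof -
  have "(\<Prod>i = 0..<n. R i (p i)) = (\<Sum>x\<in>X. c x * (\<Prod>i = 0..<n. (R(u := r x)) i (p i)))"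
    if "p permutes {0..<n}" for p
  proof -
    have pu: "p u < n" using permutes_in_image[OF that, of u] u by auto
    have split: "(\<Prod>i = 0..<n. F i (p i)) = F u (p u) * (\<Prod>i\<in>{0..<n} - {u}. F i (p i))"
      for F :: "nat \<Rightarrow> nat \<Rightarrow> real"
      using u by (subst prod.remove[of _ u]) auto
    have "(\<Prod>i\<in>{0..<n} - {u}. (R(u := r x)) i (p i)) = (\<Prod>i\<in>{0..<n} - {u}. R i (p i))" for x
      by (rule prod.cong) auto
    then show ?thesis
      unfolding split by (simp add: R[OF pu] sum_distrib_right mult.assoc)
  qed
  then have "fdet n R = (\<Sum>p | p permutes {0..<n}. \<Sum>x\<in>X.
      c x * (signof p * (\<Prod>i = 0..<n. (R(u := r x)) i (p i))))"
    unfolding fdet_leibniz by (intro sum.cong) (auto simp: sum_distrib_left algebra_simps)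
  then show ?thesis
    unfolding fdet_leibniz by (subst (asm) sum.swap) (simp add: sum_distrib_left)
qed

lemma fdet_equal_rows:
  assumes "i < n" "i' < n" "i \<noteq> i'" "\<And>j. j < n \<Longrightarrow> R i j = R i' j"
  shows "fdet n R = 0"
  unfolding fdet_def
  by (rule det_identical_rows[of _ n i i']) (use assms in \<open>auto intro!: eq_vecI\<close>)

text \<open>Every permutation picks some entry of column \<open>c\<close>, so each Leibniz summand
  vanishes.\<close>

lemma fdet_zero_column:
  assumes c: "c < n" and R: "\<And>i. i < n \<Longrightarrow> R i c = 0"
  shows "fdet n R = 0"
proof -
  have "(\<Prod>i = 0..<n. R i (p i)) = 0" if p: "p permutes {0..<n}" for p
  proof -
    obtain i where "i < n" "p i = c"
      using permutes_surj[OF p] permutes_in_image[OF p] c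
      by (metis atLeast0LessThan lessThan_iff surj_def)
    then show ?thesis using R[of i] by (intro prod_zero) (auto intro!: bexI[of _ i])
  qed
  then show ?thesis unfolding fdet_leibniz by (intro sum.neutral) auto
qed

lemma fdet_kernel:
  assumes "\<And>i. i < n \<Longrightarrow> (\<Sum>j<n. R i j * x j) = 0" and "v < n" "x v \<noteq> 0"
  shows "fdet n R = 0"
proof -
  let ?M = "mat n n (\<lambda>(i, j). R i j)"
  have "vec n x \<in> carrier_vec n" "vec n x \<noteq> 0\<^sub>v n"
    using assms(2,3) by (auto simp: vec_eq_iff)
  moreover have "?M *\<^sub>v vec n x = 0\<^sub>v n"
    using assms(1) by (auto simp: scalar_prod_def atLeast0LessThan intro!: eq_vecI)
  ultimately show ?thesis
    unfolding fdet_def using det_0_iff_vec_prod_zero[of ?M n] by fastforce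
qed

lemma fdet_identity: "fdet n (\<lambda>i j. of_bool (i = j)) = 1"
proof -
  have "mat n n (\<lambda>(i, j). of_bool (i = j)) = (1\<^sub>m n :: real mat)" by (auto intro!: eq_matI)
  then show ?thesis unfolding fdet_def by simp
qed

text \<open>The row of an element of \<open>S\<close> is \<open>c\<close> times a unit vector minus
  the row of \<open>v\<close>; by linearity the second part repeats row \<open>v\<close> and
  vanishes, so each element contributes a factor \<open>c\<close>. With \<open>S\<close> empty, row
  \<open>v\<close> expands into unit vectors, and all but the one at \<open>v\<close> repeat another
  row of the identity.\<close>

lemma fdet_complete_ones:
  assumes S: "finite S" and v: "v \<notin> S" "v \<in> e" "v < n" and e: "S \<subseteq> e" "e \<subseteq> {..<n}"
  shows "fdet n (\<lambda>i j. if i = v then of_bool (j \<in> e)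
           else if i \<in> S then c * of_bool (i = j) - of_bool (j \<in> e) else of_bool (i = j)) = c ^ card S"
  using S v(1) e
proof (induction S rule: finite_induct)
  case empty
  have "fdet n (\<lambda>i j. if i = v then of_bool (j \<in> e) else of_bool (i = j)) =
    (\<Sum>x\<in>e. 1 * fdet n ((\<lambda>i j. if i = v then of_bool (j \<in> e) else of_bool (i = j))
       (v := (\<lambda>j. of_bool (x = j)))))"
    using \<open>v < n\<close> finite_subset[OF e(2)] by (intro fdet_row_linear) (auto simp: of_bool_def)
  also have "\<dots> = (\<Sum>x\<in>e. if x = v then 1 else 0)"
  proof (rule sum.cong[OF refl])
    fix x assume x: "x \<in> e"
    let ?R = "(\<lambda>i j. if i = v then of_bool (j \<in> e) else of_bool (i = j))(v := (\<lambda>j. of_bool (x = j)))"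
    show "1 * fdet n ?R = (if x = v then 1 else 0)"
    proof (cases "x = v")
      case True
      have "fdet n ?R = fdet n (\<lambda>i j. of_bool (i = j))"
        using True by (intro fdet_cong) auto
      then show ?thesis using True fdet_identity by simp
    next
      case False
      have "fdet n ?R = 0"
        using False \<open>v < n\<close> x e(2) by (intro fdet_equal_rows[of v n x]) auto
      then show ?thesis using False by simp
    qed
  qed
  finally show ?case using v(2) finite_subset[OF e(2)] by (simp cong: if_cong)
next
  case (insert u S)
  have un: "u < n" using insert by auto
  have uv: "u \<noteq> v" using insert by auto
  let ?R = "\<lambda>i j. if i = v then of_bool (j \<in> e)
     else if i \<in> insert u S then c * of_bool (i = j) - of_bool (j \<in> e) else of_bool (i = j)"
  define r where "r b = (if b then (\<lambda>j. of_bool (u = j)) else (\<lambda>j. of_bool (j \<in> e)) :: nat \<Rightarrow> real)" for b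
  have "fdet n ?R = (\<Sum>b\<in>UNIV. (if b then c else -1) * fdet n (?R(u := r b)))"
    using un uv by (intro fdet_row_linear) (auto simp: UNIV_bool r_def)
  also have "\<dots> = c * fdet n (?R(u := r True)) - fdet n (?R(u := r False))"
    by (simp add: UNIV_bool)
  also have "fdet n (?R(u := r False)) = 0"
    using un uv \<open>v < n\<close> by (intro fdet_equal_rows[of u n v]) (auto simp: r_def)
  also have "fdet n (?R(u := r True)) = c ^ card S"
  proof -
    have "fdet n (?R(u := r True)) = fdet n (\<lambda>i j. if i = v then of_bool (j \<in> e)
           else if i \<in> S then c * of_bool (i = j) - of_bool (j \<in> e) else of_bool (i = j))"
      using uv insert.hyps by (intro fdet_cong) (auto simp: r_def)
    then show ?thesis using insert by simp
  qed
  finally show ?case using insert.hyps by simp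
qed

text \<open>
  For \<open>c = card e\<close> and \<open>S = e - {w}\<close> this counts the spanning trees of the complete graph on \<open>e\<close>
  (Cayley's formula).
\<close>

lemma fdet_complete:
  assumes S: "finite S" and e: "S \<subseteq> e" "e \<subseteq> {..<n}" and c: "c \<noteq> 0"
  shows "fdet n (\<lambda>i j. if i \<in> S then c * of_bool (i = j) - of_bool (j \<in> e) else of_bool (i = j))
     = c ^ card S * (1 - real (card S) / c)"
  using S e(1)
proof (induction S rule: finite_induct)
  case empty
  then show ?case using fdet_identity by simp
next
  case (insert u S)
  have un: "u < n" using insert e by auto
  let ?R = "\<lambda>i j. if i \<in> insert u S then c * of_bool (i = j) - of_bool (j \<in> e) else of_bool (i = j)"
  define r where "r b = (if b then (\<lambda>j. of_bool (u = j)) else (\<lambda>j. of_bool (j \<in> e)) :: nat \<Rightarrow> real)" for b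
  have "fdet n ?R = (\<Sum>b\<in>UNIV. (if b then c else -1) * fdet n (?R(u := r b)))"
    using un by (intro fdet_row_linear) (auto simp: UNIV_bool r_def)
  also have "\<dots> = c * fdet n (?R(u := r True)) - fdet n (?R(u := r False))"
    by (simp add: UNIV_bool)
  also have "fdet n (?R(u := r True)) = fdet n (\<lambda>i j.
      if i \<in> S then c * of_bool (i = j) - of_bool (j \<in> e) else of_bool (i = j))"
    using insert.hyps by (intro fdet_cong) (auto simp: r_def)
  also have "\<dots> = c ^ card S * (1 - real (card S) / c)" using insert by simp
  also have "fdet n (?R(u := r False)) = fdet n (\<lambda>i j. if i = u then of_bool (j \<in> e)
           else if i \<in> S then c * of_bool (i = j) - of_bool (j \<in> e) else of_bool (i = j))"
    using insert.hyps by (intro fdet_cong) (auto simp: r_def)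
  also have "\<dots> = c ^ card S"
    using insert un e by (intro fdet_complete_ones) auto
  \<comment> \<open>With D(S) for the determinant this is D(S + u) = c D(S) - c^card S; dividing by
    c^(card S + 1) shows that each new row lowers the bracket by 1 / c.\<close>
  finally show ?case using insert.hyps c by (simp add: field_simps)
qed

section \<open>Eulerian trails and the BEST theorem\<close>

definition out_deg :: "nat \<Rightarrow> (nat \<Rightarrow> nat \<Rightarrow> nat) \<Rightarrow> nat \<Rightarrow> nat" where
  "out_deg n m v = (\<Sum>x<n. m v x)"

definition in_deg :: "nat \<Rightarrow> (nat \<Rightarrow> nat \<Rightarrow> nat) \<Rightarrow> nat \<Rightarrow> nat" where
  "in_deg n m v = (\<Sum>x<n. m x v)"

text \<open>Truncation at multiplicity zero is harmless: in \<open>trails\<close> such a term is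
  multiplied by \<open>m u x = 0\<close>.\<close>

definition del_arc :: "(nat \<Rightarrow> nat \<Rightarrow> nat) \<Rightarrow> nat \<Rightarrow> nat \<Rightarrow> nat \<Rightarrow> nat \<Rightarrow> nat" where
  "del_arc m u x = m(u := (m u)(x := m u x - 1))"

text \<open>
  The number of trails of length \<open>L\<close> from \<open>u\<close> to \<open>w\<close> that use every arc of the multidigraph \<open>m\<close> exactly
  once, where the \<open>m i j\<close> parallel arcs from \<open>i\<close> to \<open>j\<close> are distinguished.
\<close>

primrec trails :: "nat \<Rightarrow> nat \<Rightarrow> nat \<Rightarrow> nat \<Rightarrow> (nat \<Rightarrow> nat \<Rightarrow> nat) \<Rightarrow> real" where
  "trails n 0 u w m = of_bool (u = w \<and> (\<forall>i j. m i j = 0))"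
| "trails n (Suc L) u w m = (\<Sum>x<n. real (m u x) * trails n L x w (del_arc m u x))"

text \<open>Degrees and trail steps range over vertices below \<open>n\<close>, whereas the terminal
  condition of \<open>trails\<close> inspects all pairs; this property reconciles the two.\<close>

definition supported :: "nat \<Rightarrow> (nat \<Rightarrow> nat \<Rightarrow> nat) \<Rightarrow> bool" where
  "supported n m \<longleftrightarrow> (\<forall>i j. m i j \<noteq> 0 \<longrightarrow> i < n \<and> j < n)"

text \<open>The degree condition for an Eulerian trail from \<open>u\<close> to \<open>w\<close>, in
  additive form to avoid truncated subtraction; the two corrections cancel when
  \<open>u = w\<close>.\<close>

definition balanced :: "nat \<Rightarrow> (nat \<Rightarrow> nat \<Rightarrow> nat) \<Rightarrow> nat \<Rightarrow> nat \<Rightarrow> bool" where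
  "balanced n m u w \<longleftrightarrow>
     (\<forall>v<n. in_deg n m v + of_bool (v = u) = out_deg n m v + of_bool (v = w))"

lemma supported_del_arc: "supported n m \<Longrightarrow> supported n (del_arc m u x)"
  unfolding supported_def del_arc_def by (metis diff_0_eq_0 fun_upd_apply)

lemma del_arc_other: "v \<noteq> u \<Longrightarrow> del_arc m u x v = m v"
  by (simp add: del_arc_def)

lemma out_deg_del_arc:
  assumes "m u x > 0" "x < n"
  shows "out_deg n m v = out_deg n (del_arc m u x) v + of_bool (v = u)"
proof (cases "v = u")
  case True
  have "(\<Sum>y\<in>{..<n} - {x}. del_arc m u x u y) = (\<Sum>y\<in>{..<n} - {x}. m u y)"
    by (rule sum.cong) (auto simp: del_arc_def)
  then show ?thesis
    using assms True by (simp add: out_deg_def sum.remove[of "{..<n}" x] del_arc_def)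
qed (simp add: out_deg_def del_arc_def)

lemma in_deg_del_arc:
  assumes "m u x > 0" "u < n"
  shows "in_deg n m v = in_deg n (del_arc m u x) v + of_bool (v = x)"
proof (cases "v = x")
  case True
  have "(\<Sum>y\<in>{..<n} - {u}. del_arc m u x y x) = (\<Sum>y\<in>{..<n} - {u}. m y x)"
    by (rule sum.cong) (auto simp: del_arc_def)
  then show ?thesis
    using assms True by (simp add: in_deg_def sum.remove[of "{..<n}" u] del_arc_def)
next
  case False
  then have "del_arc m u x y v = m y v" for y by (simp add: del_arc_def)
  then show ?thesis using False by (simp add: in_deg_def)
qed

text \<open>Traversing the arc costs one out-degree at \<open>u\<close> and one in-degree at
  \<open>x\<close>, which is exactly the effect of moving the start from \<open>u\<close> to
  \<open>x\<close>.\<close>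

lemma balanced_del_arc:
  assumes "m u x > 0" "u < n" "x < n"
  shows "balanced n (del_arc m u x) x w \<longleftrightarrow> balanced n m u w"
  unfolding balanced_def
  using in_deg_del_arc[of m u x n] out_deg_del_arc[of m u x n] assms by (simp add: ac_simps)

lemma total_del_arc:
  assumes "m u x > 0" "u < n" "x < n"
  shows "(\<Sum>v<n. out_deg n m v) = Suc (\<Sum>v<n. out_deg n (del_arc m u x) v)"
  using out_deg_del_arc[of m u x n] assms by (simp add: sum.distrib)

lemma del_arc_nonzeroD: "del_arc m u x i j \<noteq> 0 \<Longrightarrow> m i j \<noteq> 0"
  by (metis del_arc_def diff_0_eq_0 fun_upd_apply)

lemma trails_nonzeroD:
  assumes "trails n L u w m \<noteq> 0" "supported n m" "u < n"
  shows "balanced n m u w \<and> (\<Sum>v<n. out_deg n m v) = L"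
  using assms
proof (induction L arbitrary: u m)
  case 0
  then show ?case by (auto simp: balanced_def out_deg_def in_deg_def split: if_splits)
next
  case (Suc L)
  obtain x where x: "x < n" "m u x > 0" "trails n L x w (del_arc m u x) \<noteq> 0"
    using Suc.prems(1) by (auto elim!: sum.not_neutral_contains_not_neutral)
  show ?case
    using Suc.IH[OF x(3) supported_del_arc[OF \<open>supported n m\<close>] x(1)] balanced_del_arc[of m u x n w]
      total_del_arc[of m u x n] x \<open>u < n\<close> by simp
qed

text \<open>A trail that starts in a set closed under arcs never leaves it, yet it uses every arc,
  so every arc starts in that set. This is the form in which connectivity is used.\<close>

lemma trails_closed_set:
  assumes "trails n L u w m \<noteq> 0" "u \<in> X" "\<And>i j. i \<in> X \<Longrightarrow> m i j \<noteq> 0 \<Longrightarrow> j \<in> X"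
  shows "m i j \<noteq> 0 \<Longrightarrow> i \<in> X"
  using assms
proof (induction L arbitrary: u m)
  case 0
  then show ?case by (auto split: if_splits)
next
  case (Suc L)
  obtain x where x: "x < n" "m u x > 0" "trails n L x w (del_arc m u x) \<noteq> 0"
    using Suc.prems(2) by (auto elim!: sum.not_neutral_contains_not_neutral)
  show ?case
  proof (cases "i = u")
    case False
    then have "del_arc m u x i j \<noteq> 0" using Suc.prems(1) by (simp add: del_arc_def)
    then show ?thesis
      using Suc.IH[of "del_arc m u x" x] x Suc.prems del_arc_nonzeroD by (metis gr_implies_not0)
  qed (use Suc.prems in simp)
qed

text \<open>Deletion of an arc is transported along \<open>h\<close>. The two ambient sizes may
  differ because all arcs stay inside \<open>V\<close> and its image; this is what frees the clique
  constant from \<open>n\<close> and from the position of the clique.\<close>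

lemma trails_relabel:
  assumes h: "inj_on h V" and V: "V \<subseteq> {..<n}" "h ` V \<subseteq> {..<n'}"
    and "\<And>i j. m i j \<noteq> 0 \<Longrightarrow> i \<in> V \<and> j \<in> V"
    and "\<And>i j. m' i j \<noteq> 0 \<Longrightarrow> i \<in> h ` V \<and> j \<in> h ` V"
    and "\<And>i j. i \<in> V \<Longrightarrow> j \<in> V \<Longrightarrow> m' (h i) (h j) = m i j"
    and "u \<in> V" "w \<in> V"
  shows "trails n L u w m = trails n' L (h u) (h w) m'"
  using assms(4-)
proof (induction L arbitrary: u m m')
  case 0
  have "(\<forall>i j. m i j = 0) \<longleftrightarrow> (\<forall>i j. m' i j = 0)"
    using 0(1-3) by (metis (no_types, opaque_lifting) imageE)
  then show ?case using h 0 by (simp add: inj_on_eq_iff)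
next
  case (Suc L)
  have eq: "trails n L x w (del_arc m u x) = trails n' L (h x) (h w) (del_arc m' (h u) (h x))"
    if "x \<in> V" for x
  proof (rule Suc.IH)
    show "del_arc m u x i j \<noteq> 0 \<Longrightarrow> i \<in> V \<and> j \<in> V" for i j
      using Suc.prems(1) del_arc_nonzeroD by blast
    show "del_arc m' (h u) (h x) i j \<noteq> 0 \<Longrightarrow> i \<in> h ` V \<and> j \<in> h ` V" for i j
      using Suc.prems(2) del_arc_nonzeroD by blast
    show "del_arc m' (h u) (h x) (h i) (h j) = del_arc m u x i j" if "i \<in> V" "j \<in> V" for i j
      using Suc.prems(3,4) that \<open>x \<in> V\<close> h by (auto simp: del_arc_def inj_on_eq_iff)
  qed (use that Suc.prems in auto)
  have z: "m u x = 0" if "x \<notin> V" for x using Suc.prems(1) that by blast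
  have z': "m' (h u) x = 0" if "x \<notin> h ` V" for x using Suc.prems(2) that by blast
  have "trails n (Suc L) u w m = (\<Sum>x\<in>V. real (m u x) * trails n L x w (del_arc m u x))"
    using V(1) z by (auto intro!: sum.mono_neutral_right)
  also have "\<dots> = (\<Sum>x\<in>V. real (m' (h u) (h x)) * trails n' L (h x) (h w) (del_arc m' (h u) (h x)))"
    using Suc.prems(3,4) eq by (intro sum.cong) auto
  also have "\<dots> = (\<Sum>y\<in>h ` V. real (m' (h u) y) * trails n' L y (h w) (del_arc m' (h u) y))"
    using h by (simp add: sum.reindex)
  also have "\<dots> = trails n' (Suc L) (h u) (h w) m'"
    using V(2) z' by (auto intro!: sum.mono_neutral_left)
  finally show ?case .
qed

text \<open>
  The rows of the root \<open>w\<close> and of the vertices without outgoing arcs are replaced by unit vectors, so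
  that all vertex sets are covered by determinants of the same size \<open>n\<close>.
\<close>

definition laplacian :: "nat \<Rightarrow> (nat \<Rightarrow> nat \<Rightarrow> nat) \<Rightarrow> nat \<Rightarrow> nat \<Rightarrow> nat \<Rightarrow> real" where
  "laplacian n m w v j =
     (if v = w \<or> out_deg n m v = 0 then of_bool (v = j)
      else real (out_deg n m v) * of_bool (v = j) - real (m v j))"

text \<open>
  The BEST theorem. Both sides satisfy the same recurrence in the first arc of the trail; for the
  right-hand side this is the linearity of the determinant in the row of the initial vertex.
\<close>

lemma trails_eq_det:
  assumes "supported n m" "u < n" "w < n" "balanced n m u w" "(\<Sum>v<n. out_deg n m v) = L"
  shows "trails n L u w m =
    fact (out_deg n m w) * (\<Prod>v\<in>{..<n} - {w}. fact (out_deg n m v - 1)) * fdet n (laplacian n m w)"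
  using assms
proof (induction L arbitrary: u m)
  case 0
  have "out_deg n m i = 0" if "i < n" for i using 0(5) that by simp
  then have "m i j = 0" if "i < n" "j < n" for i j using that by (simp add: out_deg_def)
  then have z: "m i j = 0" for i j using 0(1) unfolding supported_def by blast
  have out: "out_deg n m v = 0" for v by (simp add: out_deg_def z)
  have "in_deg n m u = 0" by (simp add: in_deg_def z)
  then have "u = w" using 0(2,4) out[of u] by (cases "u = w") (auto simp: balanced_def)
  moreover have "fdet n (laplacian n m w) = 1"
    using fdet_identity[of n] by (simp add: laplacian_def[abs_def] out)
  moreover have "trails n 0 u w m = of_bool (u = w)" using z by simp
  ultimately show ?case by (simp del: trails.simps add: out)
next
  case (Suc L)
  note sup = \<open>supported n m\<close> and u = \<open>u < n\<close> and w = \<open>w < n\<close> and bal = \<open>balanced n m u w\<close>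
  have IH: "trails n L x w (del_arc m u x) = fact (out_deg n (del_arc m u x) w) *
      (\<Prod>v\<in>{..<n} - {w}. fact (out_deg n (del_arc m u x) v - 1)) * fdet n (laplacian n (del_arc m u x) w)"
    if "x < n" "m u x > 0" for x
    using Suc.IH[of "del_arc m u x" x] supported_del_arc[OF sup] that w bal Suc.prems(5)
      balanced_del_arc[of m u x n w] total_del_arc[of m u x n] u by simp
  show ?case
  proof (cases "u = w")
    case True
    show ?thesis
    proof (cases "out_deg n m w = 0")
      case out0: True
      then have "trails n (Suc L) u w m = 0" using True by (auto simp: out_deg_def)
      moreover have "fdet n (laplacian n m w) = 0"
      proof -
        \<comment> \<open>By balance no arc enters a vertex of out-degree zero, \<open>w\<close>
          among them. Every row of the Laplacian thus annihilates the indicator of the vertices with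
          outgoing arcs.\<close>
        define x :: "nat \<Rightarrow> real" where "x v = of_bool (out_deg n m v > 0)" for v
        obtain v where v: "v < n" "out_deg n m v \<noteq> 0"
          using Suc.prems(5) by (metis (no_types, lifting) lessThan_iff nat.simps(3) sum.neutral)
        have "(\<Sum>j<n. laplacian n m w i j * x j) = 0" if "i < n" for i
        proof (cases "i = w \<or> out_deg n m i = 0")
          case True
          then have "(\<Sum>j<n. laplacian n m w i j * x j) = (\<Sum>j<n. if i = j then x i else 0)"
            by (intro sum.cong) (auto simp: laplacian_def)
          also have "\<dots> = x i" using that by simp
          finally show ?thesis using True out0 by (auto simp: x_def)
        next
          case False
          have "real (m i j) * x j = real (m i j)" if "j < n" for j
          proof (cases "out_deg n m j = 0")
            case True
            then have "in_deg n m j = 0" using bal \<open>u = w\<close> that by (auto simp: balanced_def)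
            then show ?thesis using \<open>i < n\<close> by (simp add: in_deg_def)
          qed (simp add: x_def)
          then have "(\<Sum>j<n. laplacian n m w i j * x j) =
            (\<Sum>j<n. if i = j then real (out_deg n m i) * x i else 0) - (\<Sum>j<n. real (m i j))"
            unfolding sum_subtractf[symmetric] using False
            by (intro sum.cong) (auto simp: laplacian_def algebra_simps)
          also have "\<dots> = real (out_deg n m i) * x i - real (out_deg n m i)"
            using that by (simp add: out_deg_def)
          finally show ?thesis using False by (simp add: x_def)
        qed
        then show ?thesis by (rule fdet_kernel[of n _ x v]) (use v in \<open>auto simp: x_def\<close>)
      qed
      ultimately show ?thesis by simp
    next
      case out: False
      have key: "real (m u x) * trails n L x w (del_arc m u x) = real (m u x) *
         (fact (out_deg n m w - 1) * (\<Prod>v\<in>{..<n} - {w}. fact (out_deg n m v - 1)) * fdet n (laplacian n m w))"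
        if "x < n" for x
      proof (cases "m u x > 0")
        case mx: True
        have o: "out_deg n (del_arc m w x) v = out_deg n m v - of_bool (v = w)" for v
          using out_deg_del_arc[of m u x n v] mx that True by auto
        \<comment> \<open>The row of the root is a unit vector whatever its arcs, so deleting an arc
          at \<open>u = w\<close> affects only the factorial of the root.\<close>
        have "laplacian n (del_arc m u x) w = laplacian n m w"
          by (intro ext) (auto simp: laplacian_def o del_arc_other True)
        moreover have "(\<Prod>v\<in>{..<n} - {w}. fact (out_deg n (del_arc m u x) v - 1)) =
          (\<Prod>v\<in>{..<n} - {w}. fact (out_deg n m v - 1) :: real)"
          by (rule prod.cong) (auto simp: o True)
        ultimately show ?thesis using IH[OF that mx] by (simp add: o True)
      qed simp
      have "trails n (Suc L) u w m = (\<Sum>x<n. real (m u x)) *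
         (fact (out_deg n m w - 1) * (\<Prod>v\<in>{..<n} - {w}. fact (out_deg n m v - 1)) * fdet n (laplacian n m w))"
        unfolding trails.simps sum_distrib_right by (intro sum.cong refl key) simp
      also have "(\<Sum>x<n. real (m u x)) = real (out_deg n m w)" by (simp add: out_deg_def True)
      finally show ?thesis using out by (simp add: fact_reduce)
    qed
  next
    case False
    have out: "out_deg n m u = Suc (in_deg n m u)"
      using bal u False by (auto simp: balanced_def)
    define r where "r = out_deg n m u"
    have r: "r > 0" using out by (simp add: r_def)
    have r_sum: "(\<Sum>x<n. real (m u x)) = real r" by (simp add: r_def out_deg_def)
    define P where "P = (\<Prod>v\<in>{..<n} - {w} - {u}. fact (out_deg n m v - 1) :: real)"
    have o: "out_deg n (del_arc m u x) v = out_deg n m v - of_bool (v = u)" if "x < n" "m u x > 0" for x v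
      using out_deg_del_arc[of m u x n v] that by auto
    have P: "(\<Prod>v\<in>{..<n} - {w}. fact (f v - 1) :: real) = fact (f u - 1) * P"
      if "\<And>v. v \<noteq> u \<Longrightarrow> f v = out_deg n m v" for f
    proof -
      have "(\<Prod>v\<in>{..<n} - {w}. fact (f v - 1) :: real) =
        fact (f u - 1) * (\<Prod>v\<in>{..<n} - {w} - {u}. fact (f v - 1))"
        using u False by (intro prod.remove) auto
      also have "(\<Prod>v\<in>{..<n} - {w} - {u}. fact (f v - 1) :: real) = P"
        unfolding P_def by (rule prod.cong) (auto simp: that)
      finally show ?thesis .
    qed
    \<comment> \<open>The deletion leaves out-degree \<open>r - 1\<close> at \<open>u\<close>, hence
      the factorial of \<open>r - 2\<close>; for \<open>r = 1\<close> the truncated difference gives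
      0!, as required.\<close>
    have step: "trails n (Suc L) u w m = fact (out_deg n m w) * fact (r - 2) * P *
        (\<Sum>x<n. real (m u x) * fdet n (laplacian n (del_arc m u x) w))"
    proof -
      have key: "real (m u x) * trails n L x w (del_arc m u x) = fact (out_deg n m w) * fact (r - 2) * P *
          (real (m u x) * fdet n (laplacian n (del_arc m u x) w))" if "x < n" for x
      proof (cases "m u x > 0")
        case True
        have "(\<Prod>v\<in>{..<n} - {w}. fact (out_deg n (del_arc m u x) v - 1) :: real) = fact (r - 2) * P"
          by (subst P) (auto simp: o[OF that True] r_def numeral_2_eq_2)
        then show ?thesis using IH[OF that True] False by (simp add: o[OF that True])
      qed simp
      show ?thesis unfolding trails.simps sum_distrib_left by (intro sum.cong refl key) simp
    qed
    have goal: "fact (out_deg n m w) * (\<Prod>v\<in>{..<n} - {w}. fact (out_deg n m v - 1)) * fdet n (laplacian n m w)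
      = fact (out_deg n m w) * (fact (r - 1) * P) * fdet n (laplacian n m w)"
      by (subst P) (auto simp: r_def)
    let ?A = "laplacian n m w"
    \<comment> \<open>The row of \<open>u\<close> is \<open>r\<close> times its own unit vector
      minus one unit vector per outgoing arc; \<open>D x\<close> is the determinant with that row
      replaced by the unit vector at \<open>x\<close>.\<close>
    define D where "D x = fdet n (?A(u := (\<lambda>j. of_bool (x = j))))" for x
    have A_u: "?A u j = real r * of_bool (u = j) - real (m u j)" for j
      using False r by (simp add: laplacian_def r_def)
    have mu: "real (m u j) = (\<Sum>x<n. real (m u x) * of_bool (x = j))" if "j < n" for j
    proof -
      have "(\<Sum>x<n. real (m u x) * of_bool (x = j)) = (\<Sum>x<n. if x = j then real (m u j) else 0)"
        by (rule sum.cong) auto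
      then show ?thesis using that by simp
    qed
    have det_split: "fdet n ?A = real r * D u - (\<Sum>x<n. real (m u x) * D x)"
    proof -
      \<comment> \<open>\<open>None\<close> indexes the degree term, kept apart from the arc terms
        because \<open>u\<close> may itself be the head of one of its arcs.\<close>
      define c where "c b = (case b of None \<Rightarrow> real r | Some x \<Rightarrow> - real (m u x))" for b
      define f where "f b = (case b of None \<Rightarrow> u | Some x \<Rightarrow> x)" for b
      have S: "(\<Sum>b\<in>insert None (Some ` {..<n}). g b) = g None + (\<Sum>x<n. g (Some x))" for g :: "nat option \<Rightarrow> real"
        by (subst sum.insert) (auto simp: sum.reindex)
      have row: "?A u j = (\<Sum>b\<in>insert None (Some ` {..<n}). c b * of_bool (f b = j))" if "j < n" for j
        unfolding S A_u by (subst mu[OF that]) (simp add: c_def f_def sum_negf)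
      have "fdet n ?A = (\<Sum>b\<in>insert None (Some ` {..<n}). c b * fdet n (?A(u := (\<lambda>j. of_bool (f b = j)))))"
        by (rule fdet_row_linear[OF u]) (rule row)
      then show ?thesis by (simp add: S c_def f_def D_def sum_negf)
    qed
    show ?thesis
    proof (cases "r = 1")
      case r1: True
      \<comment> \<open>Deleting the only outgoing arc turns the row of \<open>u\<close> into a unit
        vector, so the row update used for \<open>r \<ge> 2\<close> fails here. By balance nothing
        enters \<open>u\<close>; its column vanishes outside its own row, and only
        \<open>D u\<close> survives.\<close>
      have col: "m i u = 0" if "i < n" for i
        using out r1 that by (auto simp: r_def in_deg_def)
      have "D x = 0" if "x < n" "x \<noteq> u" for x
        unfolding D_def using that u col
        by (intro fdet_zero_column[of u]) (auto simp: laplacian_def)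
      then have "(\<Sum>x<n. real (m u x) * D x) = 0"
        using col u by (intro sum.neutral) (metis lessThan_iff mult_zero_left mult_zero_right of_nat_0)
      then have det: "fdet n ?A = D u" using det_split r1 by simp
      have "fdet n (laplacian n (del_arc m u x) w) = D u" if "x < n" "m u x > 0" for x
      proof -
        have "laplacian n (del_arc m u x) w = ?A(u := (\<lambda>j. of_bool (u = j)))"
          using False r1 by (intro ext) (auto simp: laplacian_def o[OF that] r_def del_arc_other)
        then show ?thesis by (simp add: D_def)
      qed
      then have "(\<Sum>x<n. real (m u x) * fdet n (laplacian n (del_arc m u x) w)) = (\<Sum>x<n. real (m u x)) * D u"
        unfolding sum_distrib_right by (intro sum.cong) auto
      then show ?thesis unfolding step goal by (simp add: r_sum r1 det)
    next
      case r2: False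
      then have r2: "r \<ge> 2" using r by simp
      \<comment> \<open>Deleting an arc to \<open>x\<close> subtracts the unit vector at
        \<open>u\<close> from the row of \<open>u\<close> and adds the one at \<open>x\<close>.
        Summed over the \<open>r\<close> arcs, the \<open>D\<close> terms amount to minus the
        determinant, and the remaining factor \<open>r - 1\<close> lifts (r - 2)! to (r -
        1)!.\<close>
      have lap: "fdet n (laplacian n (del_arc m u x) w) = fdet n ?A - D u + D x"
        if "x < n" "m u x > 0" for x
      proof -
        define c where "c b = (if b = (0::nat) then 1 else if b = 1 then - 1 else (1::real))" for b
        define f where "f b = (if b = (0::nat) then ?A u else if b = 1 then (\<lambda>j. of_bool (u = j))
           else (\<lambda>j. of_bool (x = j)))" for b
        let ?B = "laplacian n (del_arc m u x) w"
        have row: "?B u j = ?A u j - of_bool (u = j) + of_bool (x = j)" for j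
        proof -
          have "out_deg n (del_arc m u x) u = r - 1" using o[OF that, of u] by (simp add: r_def)
          moreover have "real (del_arc m u x u j) = real (m u j) - of_bool (x = j)"
            using that by (auto simp: del_arc_def of_nat_diff)
          ultimately have "?B u j = real (r - 1) * of_bool (u = j) - (real (m u j) - of_bool (x = j))"
            using False r2 by (simp add: laplacian_def)
          then show ?thesis using r2 unfolding A_u by (simp add: of_nat_diff algebra_simps)
        qed
        have oth: "?B(u := g) = ?A(u := g)" for g
          by (intro ext) (auto simp: laplacian_def o[OF that] del_arc_other)
        have "fdet n ?B = (\<Sum>b\<in>{0,1,2}. c b * fdet n (?B(u := f b)))"
          by (rule fdet_row_linear[OF u]) (simp add: c_def f_def row)
        then show ?thesis unfolding oth by (simp add: c_def f_def D_def)
      qed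
      have "(\<Sum>x<n. real (m u x) * fdet n (laplacian n (del_arc m u x) w)) =
          (\<Sum>x<n. real (m u x) * (fdet n ?A - D u + D x))"
      proof (rule sum.cong[OF refl])
        fix x assume "x \<in> {..<n}"
        then show "real (m u x) * fdet n (laplacian n (del_arc m u x) w) =
          real (m u x) * (fdet n ?A - D u + D x)" using lap[of x] by (cases "m u x > 0") auto
      qed
      also have "\<dots> = real r * (fdet n ?A - D u) + (\<Sum>x<n. real (m u x) * D x)"
        unfolding r_sum[symmetric] by (simp add: distrib_left sum.distrib sum_distrib_right)
      also have "\<dots> = real (r - 1) * fdet n ?A"
        using det_split r by (simp add: of_nat_diff algebra_simps)
      finally have S: "(\<Sum>x<n. real (m u x) * fdet n (laplacian n (del_arc m u x) w)) =
          real (r - 1) * fdet n ?A" .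
      have "fact (r - 1) = real (r - 1) * fact (r - 2)"
        using r2 by (subst fact_reduce) (auto simp: numeral_2_eq_2)
      then show ?thesis unfolding step goal S by simp
    qed
  qed
qed

section \<open>Differential operators and coefficients\<close>

definition monom_fact :: "((nat \<times> nat) \<Rightarrow>\<^sub>0 nat) \<Rightarrow> real" where
  "monom_fact m = (\<Prod>v\<in>Poly_Mapping.keys m. fact (Poly_Mapping.lookup m v))"

text \<open>On these rescaled coefficients a partial derivative acts as a shift.\<close>

definition ecoeff :: "entry_poly \<Rightarrow> ((nat \<times> nat) \<Rightarrow>\<^sub>0 nat) \<Rightarrow> real" where
  "ecoeff p m = monom_fact m * Poly_Mapping.lookup p m"

lemma monom_fact_superset:
  assumes "finite S" "Poly_Mapping.keys m \<subseteq> S"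
  shows "monom_fact m = (\<Prod>v\<in>S. fact (Poly_Mapping.lookup m v))"
  unfolding monom_fact_def using assms
  by (intro prod.mono_neutral_left) (auto simp: in_keys_iff)

lemma monom_fact_0 [simp]: "monom_fact 0 = 1"
  by (simp add: monom_fact_def)

lemma monom_fact_add_single:
  "monom_fact (m + Poly_Mapping.single v 1) = (real (Poly_Mapping.lookup m v) + 1) * monom_fact m"
proof -
  let ?S = "insert v (Poly_Mapping.keys m)"
  let ?m = "m + Poly_Mapping.single v 1"
  have "Poly_Mapping.keys ?m \<subseteq> ?S"
    using keys_add[of m "Poly_Mapping.single v 1"] by auto
  then have "monom_fact ?m = fact (Poly_Mapping.lookup ?m v) *
      (\<Prod>u\<in>?S - {v}. fact (Poly_Mapping.lookup ?m u))"
    by (subst monom_fact_superset[of ?S]) (auto simp: prod.remove[of ?S v])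
  also have "(\<Prod>u\<in>?S - {v}. fact (Poly_Mapping.lookup ?m u)) =
      (\<Prod>u\<in>?S - {v}. fact (Poly_Mapping.lookup m u) :: real)"
    by (rule prod.cong) (auto simp: lookup_add lookup_single)
  also have "fact (Poly_Mapping.lookup ?m v) =
      (real (Poly_Mapping.lookup m v) + 1) * fact (Poly_Mapping.lookup m v)"
    by (simp add: lookup_add)
  finally show ?thesis
    by (subst monom_fact_superset[of ?S m]) (auto simp: prod.remove[of ?S v] mult.assoc)
qed

lemma lookup_partial_deriv:
  "Poly_Mapping.lookup (partial_deriv v p) m =
     (real (Poly_Mapping.lookup m v) + 1) * Poly_Mapping.lookup p (m + Poly_Mapping.single v 1)"
proof -
  let ?m = "m + Poly_Mapping.single v 1"
  let ?f = "\<lambda>m'. Poly_Mapping.lookup (Poly_Mapping.single (m' - Poly_Mapping.single v 1)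
          (real (Poly_Mapping.lookup m' v) * Poly_Mapping.lookup p m')) m"
  \<comment> \<open>Lowering the exponent of \<open>v\<close> is injective on the monomials
    containing \<open>v\<close>; the others may be sent to \<open>m\<close> as well, but with
    coefficient zero.\<close>
  have zero: "?f m' = 0" if "m' \<noteq> ?m" for m'
  proof (cases "Poly_Mapping.lookup m' v = 0")
    case False
    have "m' - Poly_Mapping.single v 1 \<noteq> m"
    proof
      assume *: "m' - Poly_Mapping.single v 1 = m"
      have "m' = ?m"
        using False by (intro poly_mapping_eqI)
          (auto simp: *[symmetric] lookup_add lookup_minus lookup_single when_def)
      with that show False by simp
    qed
    then show ?thesis by (simp add: lookup_single)
  qed simp
  have "Poly_Mapping.lookup (partial_deriv v p) m = (\<Sum>m'\<in>Poly_Mapping.keys p. ?f m')"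
    by (simp add: partial_deriv_def lookup_sum)
  also have "\<dots> = (\<Sum>m'\<in>insert ?m (Poly_Mapping.keys p). ?f m')"
    by (intro sum.mono_neutral_left) (auto simp: in_keys_iff)
  also have "\<dots> = (\<Sum>m'\<in>{?m}. ?f m')"
    using zero by (intro sum.mono_neutral_right) auto
  finally show ?thesis by (simp add: lookup_add)
qed

lemma ecoeff_partial_deriv:
  "ecoeff (partial_deriv v p) m = ecoeff p (m + Poly_Mapping.single v 1)"
  unfolding ecoeff_def lookup_partial_deriv monom_fact_add_single by simp

lemma ecoeff_partial_derivs:
  "ecoeff (foldr (\<lambda>j. partial_deriv (i, j)) \<gamma> p) m =
     ecoeff p (m + (\<Sum>j\<leftarrow>\<gamma>. Poly_Mapping.single (i, j) 1))"
  by (induction \<gamma> arbitrary: m) (auto simp: ecoeff_partial_deriv add.assoc add.commute)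

lemma ecoeff_scalar_mult: "ecoeff (scalar_poly c * p) m = c * ecoeff p m"
  unfolding ecoeff_def scalar_poly_def mult_map_scale_conv_mult[symmetric]
  by (simp add: map.rep_eq when_def)

lemma ecoeff_sum: "ecoeff (\<Sum>x\<in>X. p x) m = (\<Sum>x\<in>X. ecoeff (p x) m)"
  by (simp add: ecoeff_def lookup_sum sum_distrib_left)

section \<open>Multiplication by indeterminates and powers of the generic matrix\<close>

lemma lookup_indet_mult:
  "Poly_Mapping.lookup (indet v * p) m =
     (if Poly_Mapping.lookup m v = 0 then 0
      else Poly_Mapping.lookup p (m - Poly_Mapping.single v 1))"
proof -
  let ?e = "Poly_Mapping.single v (1::nat)"
  have "Poly_Mapping.lookup (indet v * p) m =
      Sum_any (\<lambda>l. Sum_any (\<lambda>q. Poly_Mapping.lookup p q when m = l + q) when ?e = l)"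
    by (simp add: lookup_mult indet_def lookup_single when_mult)
  also have "\<dots> = Sum_any (\<lambda>q. Poly_Mapping.lookup p q when m = ?e + q)" by simp
  also have "\<dots> = (if Poly_Mapping.lookup m v = 0 then 0 else Poly_Mapping.lookup p (m - ?e))"
  proof (cases "Poly_Mapping.lookup m v = 0")
    case True
    then have "m \<noteq> ?e + q" for q by (auto simp: lookup_add)
    then show ?thesis using True by simp
  next
    case False
    have "m = ?e + q \<longleftrightarrow> q = m - ?e" for q
    proof
      assume "q = m - ?e"
      then show "m = ?e + q"
        using False by (intro poly_mapping_eqI) (auto simp: lookup_add lookup_minus lookup_single when_def)
    qed simp
    then show ?thesis using False by simp
  qed
  finally show ?thesis .
qed

text \<open>The factorial rescaling produces the exponent as a factor: it counts which of the
  parallel arcs is traversed.\<close>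

lemma ecoeff_indet_mult:
  "ecoeff (indet v * p) m =
     real (Poly_Mapping.lookup m v) * ecoeff p (m - Poly_Mapping.single v 1)"
proof (cases "Poly_Mapping.lookup m v = 0")
  case False
  let ?m = "m - Poly_Mapping.single v 1"
  have "m = ?m + Poly_Mapping.single v 1"
    using False by (intro poly_mapping_eqI) (auto simp: lookup_add lookup_minus lookup_single when_def)
  then have "monom_fact m = (real (Poly_Mapping.lookup ?m v) + 1) * monom_fact ?m"
    using monom_fact_add_single[of ?m v] by simp
  then show ?thesis
    using False by (simp add: ecoeff_def lookup_indet_mult lookup_minus of_nat_diff)
qed (simp add: ecoeff_def lookup_indet_mult)

text \<open>Matrix powers grow on the right, whereas \<open>trails\<close> removes the first
  arc.\<close>

lemma pow_mat_Suc_left: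
  fixes A :: "'a::semiring_1 mat"
  assumes "A \<in> carrier_mat n n"
  shows "A ^\<^sub>m Suc L = A * A ^\<^sub>m L"
proof (induction L)
  case (Suc L)
  have "A ^\<^sub>m Suc (Suc L) = (A * A ^\<^sub>m L) * A" using Suc by simp
  also have "\<dots> = A * (A ^\<^sub>m L * A)" using assms by (intro assoc_mult_mat) auto
  finally show ?case by simp
qed (use assms in simp)

text \<open>A coefficient of the entry counts the walks from \<open>u\<close> to \<open>w\<close>
  that traverse each pair as often as \<open>m\<close> prescribes; the factorials in
  \<open>ecoeff\<close> label the parallel arcs. Expanding the leftmost matrix factor gives the
  recursion of \<open>trails\<close>.\<close>

lemma ecoeff_matrix_power:
  assumes "u < n" "w < n"
  shows "ecoeff ((generic_matrix n ^\<^sub>m L) $$ (u, w)) m =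
    trails n L u w (\<lambda>i j. Poly_Mapping.lookup m (i, j))"
  using assms(1)
proof (induction L arbitrary: u m)
  case 0
  have "(\<forall>i j. Poly_Mapping.lookup m (i, j) = 0) \<longleftrightarrow> m = 0"
    by (auto intro: poly_mapping_eqI)
  then show ?case
    using 0 assms(2) by (auto simp: ecoeff_def generic_matrix_def lookup_one when_def)
next
  case (Suc L)
  have G: "generic_matrix n \<in> carrier_mat n n" by (simp add: generic_matrix_def)
  have "(generic_matrix n ^\<^sub>m Suc L) $$ (u, w) =
      (\<Sum>x<n. indet (u, x) * (generic_matrix n ^\<^sub>m L) $$ (x, w))"
    unfolding pow_mat_Suc_left[OF G] using Suc.prems assms(2) G pow_carrier_mat[OF G, of L]
    by (auto simp: scalar_prod_def generic_matrix_def atLeast0LessThan)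
  moreover have "(\<lambda>i j. Poly_Mapping.lookup (m - Poly_Mapping.single (u, x) 1) (i, j)) =
      del_arc (\<lambda>i j. Poly_Mapping.lookup m (i, j)) u x" for x
    by (intro ext) (auto simp: del_arc_def lookup_minus lookup_single when_def)
  ultimately show ?case
    by (simp add: ecoeff_sum ecoeff_indet_mult Suc.IH del: pow_mat.simps)
qed

section \<open>The trace as a sum over selections\<close>

text \<open>
  The operator of row \<open>i\<close> is a sum over the loop at \<open>i\<close>, encoded as the set \<open>{i}\<close>, and the edges
  containing \<open>i\<close>. The \<open>(k - 1)!\<close> orderings of an edge cancel the factor \<open>1/(k - 1)!\<close> of the adjacency
  tensor.
\<close>

definition choices :: "nat set set \<Rightarrow> nat \<Rightarrow> nat set set" where
  "choices E i = insert {i} {e \<in> E. i \<in> e}"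

definition choice_weight :: "real \<Rightarrow> nat set set \<Rightarrow> nat \<Rightarrow> nat set \<Rightarrow> real" where
  "choice_weight \<alpha> E i X = (if X = {i} then \<alpha> * real (vertex_degree E i) else 1 - \<alpha>)"

text \<open>One arc per derivative: the loop stands for k - 1 parallel loops, an edge for one arc to
  each of its other vertices. For k \<ge> 2 an edge is never a singleton, so \<open>{i}\<close> is
  free to encode the loop.\<close>

definition choice_arcs :: "nat \<Rightarrow> nat \<Rightarrow> nat set \<Rightarrow> nat \<Rightarrow> nat" where
  "choice_arcs k i X j = (if X = {i} then (if j = i then k - 1 else 0) else of_bool (j \<in> X - {i}))"

definition choice_monom :: "nat \<Rightarrow> nat \<Rightarrow> nat set \<Rightarrow> (nat \<times> nat) \<Rightarrow>\<^sub>0 nat" where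
  "choice_monom k i X = (if X = {i} then Poly_Mapping.single (i, i) (k - 1)
     else (\<Sum>j\<in>X - {i}. Poly_Mapping.single (i, j) 1))"

lemma lookup_choice_monom:
  assumes "finite X"
  shows "Poly_Mapping.lookup (choice_monom k i X) (i', j) = (if i' = i then choice_arcs k i X j else 0)"
proof (cases "X = {i}")
  case False
  have "(\<Sum>x\<in>X - {i}. Poly_Mapping.lookup (Poly_Mapping.single (i, x) 1) (i', j)) =
     (\<Sum>x\<in>X - {i}. if x = j then of_bool (i' = i) else 0)"
    by (rule sum.cong) (auto simp: lookup_single when_def)
  also have "\<dots> = (if i' = i then choice_arcs k i X j else 0)"
    using False assms by (simp add: choice_arcs_def)
  finally show ?thesis
    using False by (simp add: choice_monom_def lookup_sum)
qed (auto simp: choice_monom_def choice_arcs_def lookup_single when_def)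

lemma sum_list_replicate_single:
  "(\<Sum>j\<leftarrow>replicate l i. Poly_Mapping.single (f j) (1::nat)) = Poly_Mapping.single (f i) l"
  by (induction l) (auto simp: single_add[symmetric] simp del: single_one)

lemma finite_uniform_hypergraph: "uniform_hypergraph k n E \<Longrightarrow> finite E"
  unfolding uniform_hypergraph_def by (rule finite_subset[of _ "Pow {..<n}"]) auto

lemma finite_choices: "finite E \<Longrightarrow> finite (choices E i)"
  by (simp add: choices_def)

text \<open>The \<open>k\<close> entries of the list \<open>i # \<gamma>\<close> must cover the
  \<open>k\<close> vertices of an edge, which leaves no room for a repetition.\<close>

lemma edge_orderings:
  assumes k: "k \<ge> 2" and E: "uniform_hypergraph k n E"
  shows "{\<gamma>. length \<gamma> = k - 1 \<and> set \<gamma> \<subseteq> {..<n} \<and> set (i # \<gamma>) \<in> E} =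
    (\<Union>e\<in>{e \<in> E. i \<in> e}. permutations_of_set (e - {i}))"
proof (intro equalityI subsetI)
  fix \<gamma> assume "\<gamma> \<in> {\<gamma>. length \<gamma> = k - 1 \<and> set \<gamma> \<subseteq> {..<n} \<and> set (i # \<gamma>) \<in> E}"
  then have \<gamma>: "length \<gamma> = k - 1" "insert i (set \<gamma>) \<in> E" by auto
  then have "card (insert i (set \<gamma>)) = k" using E by (auto simp: uniform_hypergraph_def)
  moreover have "card (set \<gamma>) \<le> k - 1" using card_length[of \<gamma>] \<gamma> by simp
  ultimately have "i \<notin> set \<gamma>" "card (set \<gamma>) = k - 1"
    using k by (auto simp: card_insert_if split: if_splits)
  then have "distinct \<gamma>" "set \<gamma> = insert i (set \<gamma>) - {i}" using \<gamma> by (auto intro: card_distinct)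
  then show "\<gamma> \<in> (\<Union>e\<in>{e \<in> E. i \<in> e}. permutations_of_set (e - {i}))"
    using \<gamma>(2) by (auto simp: permutations_of_set_def intro!: bexI[of _ "insert i (set \<gamma>)"])
next
  fix \<gamma> assume "\<gamma> \<in> (\<Union>e\<in>{e \<in> E. i \<in> e}. permutations_of_set (e - {i}))"
  then obtain e where e: "e \<in> E" "i \<in> e" "set \<gamma> = e - {i}" "distinct \<gamma>"
    by (auto simp: permutations_of_set_def)
  have "e \<subseteq> {..<n}" "card e = k" using E e(1) by (auto simp: uniform_hypergraph_def)
  moreover have "finite e" using \<open>e \<subseteq> {..<n}\<close> finite_subset by blast
  moreover have "length \<gamma> = card (e - {i})" using e distinct_card by metis
  moreover have "insert i (set \<gamma>) = e" using e by auto
  ultimately show "\<gamma> \<in> {\<gamma>. length \<gamma> = k - 1 \<and> set \<gamma> \<subseteq> {..<n} \<and> set (i # \<gamma>) \<in> E}"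
    using e by (auto simp: card_Diff_singleton)
qed

text \<open>On rescaled coefficients the operator is a finite combination of shifts, which is the
  only property of it used from here on. The degree tensor contributes the constant list; all
  orderings of an edge give the same shift.\<close>

lemma ecoeff_row_operator:
  assumes k: "k \<ge> 2" and E: "uniform_hypergraph k n E" and i: "i < n"
  shows "ecoeff (row_operator k n (A_alpha_tensor k E \<alpha>) i p) m =
    (\<Sum>X\<in>choices E i. choice_weight \<alpha> E i X * ecoeff p (m + choice_monom k i X))"
proof -
  define \<Gamma> where "\<Gamma> = {\<gamma>. length \<gamma> = k - 1 \<and> set \<gamma> \<subseteq> {..<n}}"
  define f where "f \<gamma> = ecoeff p (m + (\<Sum>j\<leftarrow>\<gamma>. Poly_Mapping.single (i, j) 1))" for \<gamma>
  define D where "D \<gamma> = (if \<gamma> = replicate (k - 1) i then real (vertex_degree E i) else 0)" for \<gamma>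
  define B where "B \<gamma> = (if set (i # \<gamma>) \<in> E then 1 / fact (k - 1) else 0 :: real)" for \<gamma>
  have fin: "finite \<Gamma>"
    unfolding \<Gamma>_def using finite_lists_length_eq[of "{..<n}" "k - 1"] by (simp add: conj_commute)
  have finE: "finite E" using finite_uniform_hypergraph[OF E] .
  have "replicate k i = i # replicate (k - 1) i" using k by (cases k) auto
  then have T: "A_alpha_tensor k E \<alpha> (i # \<gamma>) = \<alpha> * D \<gamma> + (1 - \<alpha>) * B \<gamma>" for \<gamma>
    by (simp add: A_alpha_tensor_def degree_tensor_def adjacency_tensor_def D_def B_def)
  have "ecoeff (row_operator k n (A_alpha_tensor k E \<alpha>) i p) m =
      (\<Sum>\<gamma>\<in>\<Gamma>. (\<alpha> * D \<gamma> + (1 - \<alpha>) * B \<gamma>) * f \<gamma>)"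
    by (simp add: row_operator_def ecoeff_sum ecoeff_scalar_mult ecoeff_partial_derivs T \<Gamma>_def f_def)
  also have "\<dots> = \<alpha> * (\<Sum>\<gamma>\<in>\<Gamma>. D \<gamma> * f \<gamma>) + (1 - \<alpha>) * (\<Sum>\<gamma>\<in>\<Gamma>. B \<gamma> * f \<gamma>)"
    by (simp add: distrib_right sum.distrib sum_distrib_left mult.assoc)
  also have "(\<Sum>\<gamma>\<in>\<Gamma>. D \<gamma> * f \<gamma>) = (\<Sum>\<gamma>\<in>\<Gamma>. if \<gamma> = replicate (k - 1) i
      then real (vertex_degree E i) * f \<gamma> else 0)"
    by (rule sum.cong) (auto simp: D_def)
  also have "\<dots> = real (vertex_degree E i) * f (replicate (k - 1) i)"
    using fin i by (simp add: \<Gamma>_def set_replicate_conv_if)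
  also have "f (replicate (k - 1) i) = ecoeff p (m + choice_monom k i {i})"
    unfolding f_def by (subst sum_list_replicate_single) (simp add: choice_monom_def)
  also have "(\<Sum>\<gamma>\<in>\<Gamma>. B \<gamma> * f \<gamma>) = (\<Sum>\<gamma>\<in>{\<gamma>\<in>\<Gamma>. set (i # \<gamma>) \<in> E}. 1 / fact (k - 1) * f \<gamma>)"
    unfolding sum.inter_filter[OF fin] by (rule sum.cong) (auto simp: B_def)
  also have "{\<gamma>\<in>\<Gamma>. set (i # \<gamma>) \<in> E} = (\<Union>e\<in>{e \<in> E. i \<in> e}. permutations_of_set (e - {i}))"
    using edge_orderings[OF k E, of i] by (simp add: \<Gamma>_def)
  also have "(\<Sum>\<gamma>\<in>(\<Union>e\<in>{e \<in> E. i \<in> e}. permutations_of_set (e - {i})). 1 / fact (k - 1) * f \<gamma>) =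
      (\<Sum>e\<in>{e \<in> E. i \<in> e}. \<Sum>\<gamma>\<in>permutations_of_set (e - {i}). 1 / fact (k - 1) * f \<gamma>)"
  proof (intro sum.UNION_disjoint ballI impI)
    fix e e' assume "e \<in> {e \<in> E. i \<in> e}" "e' \<in> {e \<in> E. i \<in> e}" "e \<noteq> e'"
    then have "e - {i} \<noteq> e' - {i}" by blast
    then show "permutations_of_set (e - {i}) \<inter> permutations_of_set (e' - {i}) = {}"
      by (auto simp: permutations_of_set_def)
  qed (use finE in auto)
  also have "\<dots> = (\<Sum>e\<in>{e \<in> E. i \<in> e}. ecoeff p (m + choice_monom k i e))"
  proof (rule sum.cong[OF refl])
    fix e assume "e \<in> {e \<in> E. i \<in> e}"
    then have e: "e \<subseteq> {..<n}" "card e = k" "i \<in> e" using E by (auto simp: uniform_hypergraph_def)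
    then have fe: "finite e" using finite_subset by blast
    have "f \<gamma> = ecoeff p (m + choice_monom k i e)" if "\<gamma> \<in> permutations_of_set (e - {i})" for \<gamma>
    proof -
      have "distinct \<gamma>" "set \<gamma> = e - {i}" using that by (auto simp: permutations_of_set_def)
      moreover have "e \<noteq> {i}" using e k by auto
      ultimately show ?thesis
        unfolding f_def choice_monom_def by (simp only: sum_list_distinct_conv_sum_set if_False)
    qed
    then have "(\<Sum>\<gamma>\<in>permutations_of_set (e - {i}). 1 / fact (k - 1) * f \<gamma>) =
      (\<Sum>\<gamma>\<in>permutations_of_set (e - {i}). 1 / fact (k - 1) * ecoeff p (m + choice_monom k i e))"
      by (intro sum.cong) auto
    then show "(\<Sum>\<gamma>\<in>permutations_of_set (e - {i}). 1 / fact (k - 1) * f \<gamma>) =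
        ecoeff p (m + choice_monom k i e)"
      using e fe by (simp add: card_Diff_singleton)
  qed
  also have "\<alpha> * (real (vertex_degree E i) * ecoeff p (m + choice_monom k i {i})) +
      (1 - \<alpha>) * (\<Sum>e\<in>{e \<in> E. i \<in> e}. ecoeff p (m + choice_monom k i e)) =
    (\<Sum>X\<in>choices E i. choice_weight \<alpha> E i X * ecoeff p (m + choice_monom k i X))"
  proof -
    have ne: "{i} \<notin> E" using E k by (auto simp: uniform_hypergraph_def)
    have "(\<Sum>X\<in>{e \<in> E. i \<in> e}. choice_weight \<alpha> E i X * ecoeff p (m + choice_monom k i X)) =
       (1 - \<alpha>) * (\<Sum>e\<in>{e \<in> E. i \<in> e}. ecoeff p (m + choice_monom k i e))"
      unfolding sum_distrib_left using ne by (intro sum.cong) (auto simp: choice_weight_def)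
    then show ?thesis
      unfolding choices_def using ne finE by (subst sum.insert) (auto simp: choice_weight_def)
  qed
  finally show ?thesis .
qed

text \<open>A power of a sum of shifts is a sum over words. Choices at a vertex are therefore
  ordered lists, and two different choices count once in each order.\<close>

lemma ecoeff_operator_power:
  assumes op: "\<And>p m. ecoeff (op p) m = (\<Sum>X\<in>C. w X * ecoeff p (m + a X))"
  shows "ecoeff ((op ^^ d) p) m =
    (\<Sum>g | length g = d \<and> set g \<subseteq> C. prod_list (map w g) * ecoeff p (m + sum_list (map a g)))"
proof (induction d arbitrary: m)
  case 0
  have "{g. length g = 0 \<and> set g \<subseteq> C} = {[]}" by auto
  then show ?case by simp
next
  case (Suc d)
  let ?G = "\<lambda>d. {g. length g = d \<and> set g \<subseteq> C}"
  have "ecoeff ((op ^^ Suc d) p) m =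
    (\<Sum>(X, g)\<in>C \<times> ?G d. w X * (prod_list (map w g) * ecoeff p (m + a X + sum_list (map a g))))"
    by (simp add: op Suc sum_distrib_left sum.cartesian_product)
  also have "\<dots> = (\<Sum>g\<in>?G (Suc d). prod_list (map w g) * ecoeff p (m + sum_list (map a g)))"
    by (rule sum.reindex_bij_witness[where i = "\<lambda>g. (hd g, tl g)" and j = "\<lambda>(X, g). X # g"])
      (auto simp: length_Suc_conv add.assoc)
  finally show ?case .
qed

text \<open>As \<open>xs\<close> is distinct, the words at different indices are chosen
  independently. The value \<open>[]\<close> off \<open>xs\<close> makes each family of words
  correspond to a single function \<open>s\<close>.\<close>

lemma ecoeff_operator_foldr:
  assumes "distinct xs"
    and "\<And>i p m. i \<in> set xs \<Longrightarrow> ecoeff (op i p) m = (\<Sum>X\<in>C i. w i X * ecoeff p (m + a i X))"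
  shows "ecoeff (foldr (\<lambda>i p. scalar_poly (c i) * (op i ^^ d i) p) xs p) m =
    (\<Sum>s | (\<forall>i\<in>set xs. length (s i) = d i \<and> set (s i) \<subseteq> C i) \<and> (\<forall>i. i \<notin> set xs \<longrightarrow> s i = []).
       (\<Prod>i\<in>set xs. c i * prod_list (map (w i) (s i))) *
       ecoeff p (m + (\<Sum>i\<in>set xs. sum_list (map (a i) (s i)))))"
  using assms
proof (induction xs arbitrary: m)
  case Nil
  have "{s. (\<forall>i\<in>set []. length (s i) = d i \<and> set (s i) \<subseteq> C i) \<and> (\<forall>i. i \<notin> set [] \<longrightarrow> s i = [])} = {\<lambda>_. []}"
    by auto
  then show ?case by simp
next
  case (Cons x xs)
  let ?G = "{g. length g = d x \<and> set g \<subseteq> C x}"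
  let ?S = "\<lambda>xs. {s. (\<forall>i\<in>set xs. length (s i) = d i \<and> set (s i) \<subseteq> C i) \<and> (\<forall>i. i \<notin> set xs \<longrightarrow> s i = [])}"
  let ?t = "\<lambda>xs m s. (\<Prod>i\<in>set xs. c i * prod_list (map (w i) (s i))) *
       ecoeff p (m + (\<Sum>i\<in>set xs. sum_list (map (a i) (s i))))"
  have x: "x \<notin> set xs" using Cons.prems by simp
  have IH: "ecoeff (foldr (\<lambda>i p. scalar_poly (c i) * (op i ^^ d i) p) xs p) m = sum (?t xs m) (?S xs)" for m
    using Cons.prems by (intro Cons.IH) auto
  have "ecoeff (foldr (\<lambda>i p. scalar_poly (c i) * (op i ^^ d i) p) (x # xs) p) m =
     (\<Sum>(g, s)\<in>?G \<times> ?S xs. c x * (prod_list (map (w x) g) * ?t xs (m + sum_list (map (a x) g)) s))"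
    using Cons.prems(2)
    by (simp add: ecoeff_scalar_mult ecoeff_operator_power[where op = "op x" and C = "C x" and w = "w x" and a = "a x"] IH
        sum_distrib_left sum.cartesian_product case_prod_unfold)
  also have "\<dots> = sum (?t (x # xs) m) (?S (x # xs))"
  proof (rule sum.reindex_bij_witness[where i = "\<lambda>s. (s x, s(x := []))" and j = "\<lambda>(g, s). s(x := g)"])
    fix gs assume gs: "gs \<in> ?G \<times> ?S xs"
    obtain g s where [simp]: "gs = (g, s)" by (cases gs)
    have "s x = []" using gs x by auto
    then show "(\<lambda>s. (s x, s(x := []))) ((\<lambda>(g, s). s(x := g)) gs) = gs" by auto
    show "(\<lambda>(g, s). s(x := g)) gs \<in> ?S (x # xs)" using gs x by auto
    have "(\<Prod>i\<in>set xs. c i * prod_list (map (w i) ((s(x := g)) i))) =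
        (\<Prod>i\<in>set xs. c i * prod_list (map (w i) (s i)))"
      using x by (intro prod.cong) auto
    moreover have "(\<Sum>i\<in>set xs. sum_list (map (a i) ((s(x := g)) i))) =
        (\<Sum>i\<in>set xs. sum_list (map (a i) (s i)))"
      using x by (intro sum.cong) auto
    ultimately show "?t (x # xs) m ((\<lambda>(g, s). s(x := g)) gs) =
       (case gs of (g, s) \<Rightarrow> c x * (prod_list (map (w x) g) * ?t xs (m + sum_list (map (a x) g)) s))"
      using x by (simp add: add.assoc mult.assoc)
  next
    fix s assume s: "s \<in> ?S (x # xs)"
    show "(\<lambda>(g, s). s(x := g)) (s x, s(x := [])) = s" by auto
    show "(s x, s(x := [])) \<in> ?G \<times> ?S xs" using s x by auto
  qed
  finally show ?case .
qed

text \<open>The exponents d_i of the trace reappear as list lengths, so that one sum replaces the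
  double sum over exponents and words.\<close>

definition selections :: "nat \<Rightarrow> nat set set \<Rightarrow> nat \<Rightarrow> (nat \<Rightarrow> nat set list) set" where
  "selections n E d = {s. (\<forall>i<n. set (s i) \<subseteq> choices E i) \<and> (\<forall>i\<ge>n. s i = []) \<and>
     (\<Sum>i<n. length (s i)) = d}"

definition selection_arcs :: "nat \<Rightarrow> (nat \<Rightarrow> nat set list) \<Rightarrow> nat \<Rightarrow> nat \<Rightarrow> nat" where
  "selection_arcs k s i j = (\<Sum>X\<leftarrow>s i. choice_arcs k i X j)"

definition selection_term ::
    "nat \<Rightarrow> nat \<Rightarrow> nat set set \<Rightarrow> real \<Rightarrow> nat \<Rightarrow> (nat \<Rightarrow> nat set list) \<Rightarrow> real" where
  "selection_term k n E \<alpha> d s =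
     (\<Prod>i<n. prod_list (map (choice_weight \<alpha> E i) (s i)) / fact (length (s i) * (k - 1))) *
     (\<Sum>w<n. trails n (d * (k - 1)) w w (selection_arcs k s))"

text \<open>At the trivial monomial \<open>ecoeff\<close> is the plain coefficient. The shifts carry
  it to the coefficient of the trace polynomial at the arc multiset of the selection, which counts
  closed trails over all starting points.\<close>

lemma tensor_trace_selections:
  assumes k: "k \<ge> 2" and E: "uniform_hypergraph k n E"
  shows "tensor_trace k n d (A_alpha_tensor k E \<alpha>) =
    (real k - 1) ^ (n - 1) * (\<Sum>s\<in>selections n E d. selection_term k n E \<alpha> d s)"
proof -
  let ?T = "A_alpha_tensor k E \<alpha>"
  let ?p = "mat_trace (generic_matrix n ^\<^sub>m (d * (k - 1)))"
  let ?S = "\<lambda>ds. {s. (\<forall>i\<in>set [0..<n]. length (s i) = ds ! i \<and> set (s i) \<subseteq> choices E i) \<and>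
    (\<forall>i. i \<notin> set [0..<n] \<longrightarrow> s i = [])}"
  have finE: "finite E" using finite_uniform_hypergraph[OF E] .
  have G: "generic_matrix n \<in> carrier_mat n n" by (simp add: generic_matrix_def)
  have tr: "ecoeff ?p m = (\<Sum>w<n. trails n (d * (k - 1)) w w (\<lambda>i j. Poly_Mapping.lookup m (i, j)))" for m
    using G by (simp add: mat_trace_def ecoeff_sum ecoeff_matrix_power)
  have mono: "(\<lambda>i' j. Poly_Mapping.lookup (\<Sum>i\<in>set [0..<n]. \<Sum>X\<leftarrow>s i. choice_monom k i X) (i', j)) =
      selection_arcs k s" if s: "s \<in> ?S ds" for ds s
  proof (intro ext)
    fix i' j
    have fin: "finite X" if "i < n" "X \<in> set (s i)" for i X
    proof -
      have "X \<in> choices E i" using s that by auto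
      then show ?thesis
        using E by (auto simp: choices_def uniform_hypergraph_def intro: finite_subset)
    qed
    have L: "Poly_Mapping.lookup (\<Sum>X\<leftarrow>xs. choice_monom k i X) (i', j) =
        (if i' = i then \<Sum>X\<leftarrow>xs. choice_arcs k i X j else 0)" if "\<forall>X\<in>set xs. finite X" for xs i
      using that by (induction xs) (auto simp: lookup_add lookup_choice_monom)
    have "Poly_Mapping.lookup (\<Sum>i\<in>set [0..<n]. \<Sum>X\<leftarrow>s i. choice_monom k i X) (i', j) =
       (\<Sum>i\<in>{0..<n}. if i' = i then \<Sum>X\<leftarrow>s i. choice_arcs k i X j else 0)"
      unfolding lookup_sum
    proof (rule sum.cong)
      fix i assume "i \<in> {0..<n}"
      then show "Poly_Mapping.lookup (\<Sum>X\<leftarrow>s i. choice_monom k i X) (i', j) =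
        (if i' = i then \<Sum>X\<leftarrow>s i. choice_arcs k i X j else 0)"
        using fin[of i] by (intro L) auto
    qed simp
    also have "\<dots> = (\<Sum>X\<leftarrow>s i'. choice_arcs k i' X j)"
      using s by (cases "i' < n") auto
    finally show "Poly_Mapping.lookup (\<Sum>i\<in>set [0..<n]. \<Sum>X\<leftarrow>s i. choice_monom k i X) (i', j) =
      selection_arcs k s i' j" by (simp add: selection_arcs_def)
  qed
  have prod: "ecoeff (operator_product k n ?T ds ?p) 0 = (\<Sum>s\<in>?S ds. selection_term k n E \<alpha> d s)" for ds
  proof -
    have "ecoeff (operator_product k n ?T ds ?p) 0 = (\<Sum>s\<in>?S ds.
       (\<Prod>i\<in>set [0..<n]. 1 / fact (ds ! i * (k - 1)) * prod_list (map (choice_weight \<alpha> E i) (s i))) *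
       ecoeff ?p (0 + (\<Sum>i\<in>set [0..<n]. \<Sum>X\<leftarrow>s i. choice_monom k i X)))"
      unfolding operator_product_def
      by (rule ecoeff_operator_foldr) (use ecoeff_row_operator[OF k E] in auto)
    also have "\<dots> = (\<Sum>s\<in>?S ds. selection_term k n E \<alpha> d s)"
    proof (rule sum.cong[OF refl])
      fix s assume s: "s \<in> ?S ds"
      have "(\<Prod>i\<in>set [0..<n]. 1 / fact (ds ! i * (k - 1)) * prod_list (map (choice_weight \<alpha> E i) (s i))) =
        (\<Prod>i<n. prod_list (map (choice_weight \<alpha> E i) (s i)) / fact (length (s i) * (k - 1)))"
        using s by (intro prod.cong) auto
      then show "(\<Prod>i\<in>set [0..<n]. 1 / fact (ds ! i * (k - 1)) * prod_list (map (choice_weight \<alpha> E i) (s i))) *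
       ecoeff ?p (0 + (\<Sum>i\<in>set [0..<n]. \<Sum>X\<leftarrow>s i. choice_monom k i X)) = selection_term k n E \<alpha> d s"
        unfolding selection_term_def tr add_0 mono[OF s] by simp
    qed
    finally show ?thesis .
  qed
  let ?DS = "{ds. length ds = n \<and> sum_list ds = d}"
  have finDS: "finite ?DS"
  proof (rule finite_subset)
    show "?DS \<subseteq> {ds. set ds \<subseteq> {..d} \<and> length ds = n}"
      using member_le_sum_list by fastforce
    show "finite {ds. set ds \<subseteq> {..d} \<and> length ds = n}" by (rule finite_lists_length_eq) simp
  qed
  have finG: "finite {g. set g \<subseteq> choices E i \<and> length g = l}" for i l
    by (rule finite_lists_length_eq[OF finite_choices[OF finE]])
  have finS: "finite (?S ds)" for ds
  proof (rule finite_subset)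
    let ?B = "\<Union>i<n. {g. set g \<subseteq> choices E i \<and> length g = ds ! i}"
    show "?S ds \<subseteq> {s. \<forall>i. (i \<in> {..<n} \<longrightarrow> s i \<in> ?B) \<and> (i \<notin> {..<n} \<longrightarrow> s i = [])}" by fastforce
    show "finite {s. \<forall>i. (i \<in> {..<n} \<longrightarrow> s i \<in> ?B) \<and> (i \<notin> {..<n} \<longrightarrow> s i = [])}"
      using finG by (intro finite_set_of_finite_funs) auto
  qed
  have "ecoeff (\<Sum>ds\<in>?DS. operator_product k n ?T ds ?p) 0 =
      (\<Sum>(ds, s)\<in>Sigma ?DS ?S. selection_term k n E \<alpha> d s)"
    unfolding ecoeff_sum prod using finDS finS by (intro sum.Sigma) auto
  also have "\<dots> = (\<Sum>s\<in>selections n E d. selection_term k n E \<alpha> d s)"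
    by (rule sum.reindex_bij_witness[where i = "\<lambda>s. (map (length \<circ> s) [0..<n], s)" and j = snd])
      (auto simp: selections_def sum_list_sum_nth atLeast0LessThan subset_iff intro!: nth_equalityI)
  finally show ?thesis
    by (simp add: tensor_trace_def ecoeff_def)
qed

section \<open>Selections with closed trails\<close>

definition loop_selection :: "nat \<Rightarrow> nat \<Rightarrow> nat \<Rightarrow> nat set list" where
  "loop_selection d v i = (if i = v then replicate d {v} else [])"

definition edge_selection :: "nat set \<Rightarrow> nat \<Rightarrow> nat set list" where
  "edge_selection e i = (if i \<in> e then [e] else [])"

text \<open>The flag records the order of the two choices at \<open>v\<close>.\<close>

definition edge_loop_selection :: "nat set \<Rightarrow> nat \<Rightarrow> bool \<Rightarrow> nat \<Rightarrow> nat set list" where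
  "edge_loop_selection e v b = (edge_selection e)(v := if b then [e, {v}] else [{v}, e])"

definition clique_selection :: "nat set \<Rightarrow> (nat \<Rightarrow> nat) \<Rightarrow> nat \<Rightarrow> nat set list" where
  "clique_selection V f i = (if i \<in> V then [V - {f i}] else [])"

definition clique_sets :: "nat \<Rightarrow> nat \<Rightarrow> nat set set \<Rightarrow> nat set set" where
  "clique_sets k n E = {V. V \<subseteq> {..<n} \<and> card V = Suc k \<and> (\<forall>e. e \<subseteq> V \<longrightarrow> card e = k \<longrightarrow> e \<in> E)}"

locale uniform_hypergraph_on =
  fixes k n :: nat and E :: "nat set set"
  assumes k: "k \<ge> 2" and E: "uniform_hypergraph k n E"
begin

lemma edgeD:
  assumes "e \<in> E"
  shows "e \<subseteq> {..<n}" "card e = k" "finite e"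
  using assms E finite_subset[of e "{..<n}"] by (auto simp: uniform_hypergraph_def)

lemma loop_not_edge: "{i} \<notin> E"
  using edgeD(2)[of "{i}"] k by auto

lemma choice_arcs_edge: "e \<in> E \<Longrightarrow> choice_arcs k i e j = of_bool (j \<in> e - {i})"
  using loop_not_edge by (auto simp: choice_arcs_def)

lemma sum_choice_arcs:
  assumes "i < n" "X \<in> choices E i"
  shows "(\<Sum>j<n. choice_arcs k i X j) = k - 1"
proof (cases "X = {i}")
  case True
  then show ?thesis using assms by (simp add: choice_arcs_def)
next
  case False
  then have X: "X \<in> E" "i \<in> X" using assms by (auto simp: choices_def)
  have "(\<Sum>j<n. choice_arcs k i X j) = (\<Sum>j<n. of_bool (j \<in> X - {i}))"
    by (simp add: choice_arcs_edge[OF X(1)])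
  also have "\<dots> = card ({..<n} \<inter> {j. j \<in> X - {i}})" by (subst sum_of_bool_eq) auto
  also have "{..<n} \<inter> {j. j \<in> X - {i}} = X - {i}" using edgeD[OF X(1)] by auto
  finally show ?thesis using X edgeD[OF X(1)] by (simp add: card_Diff_singleton)
qed

lemma selection_memberD:
  assumes "s \<in> selections n E d" "X \<in> set (s i)"
  shows "i < n" "X \<in> choices E i"
proof -
  show "i < n" using assms by (cases "i < n") (auto simp: selections_def)
  then show "X \<in> choices E i" using assms unfolding selections_def by blast
qed

lemma out_deg_selection:
  assumes "s \<in> selections n E d" "i < n"
  shows "out_deg n (selection_arcs k s) i = length (s i) * (k - 1)"
proof -
  have "(\<Sum>j<n. \<Sum>X\<leftarrow>xs. choice_arcs k i X j) = length xs * (k - 1)" if "set xs \<subseteq> choices E i" for xs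
    using that by (induction xs) (auto simp: sum.distrib sum_choice_arcs[OF assms(2)])
  then show ?thesis using assms by (simp add: out_deg_def selection_arcs_def selections_def)
qed

lemma selection_arcs_pos_iff:
  "selection_arcs k s i j > 0 \<longleftrightarrow> (\<exists>X\<in>set (s i). choice_arcs k i X j > 0)"
  unfolding selection_arcs_def neq0_conv[symmetric] sum_list_eq_0_iff by auto

lemma supported_selection:
  assumes "s \<in> selections n E d"
  shows "supported n (selection_arcs k s)"
  unfolding supported_def
proof (intro allI impI)
  fix i j assume "selection_arcs k s i j \<noteq> 0"
  then obtain X where X: "X \<in> set (s i)" "choice_arcs k i X j > 0"
    using selection_arcs_pos_iff[of s i j] by auto
  then have "i < n" "X \<in> choices E i" using selection_memberD[OF assms] by auto
  then show "i < n \<and> j < n"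
    using X edgeD[of X] by (auto simp: choice_arcs_def choices_def split: if_splits)
qed

lemma selection_support:
  assumes "s \<in> selections n E d"
  shows "{i. s i \<noteq> []} \<subseteq> {..<n}" "finite {i. s i \<noteq> []}" "(\<Sum>i | s i \<noteq> []. length (s i)) = d"
proof -
  show *: "{i. s i \<noteq> []} \<subseteq> {..<n}"
    using assms unfolding selections_def by (auto simp: not_less[symmetric])
  then show "finite {i. s i \<noteq> []}" using finite_subset by blast
  have "(\<Sum>i | s i \<noteq> []. length (s i)) = (\<Sum>i<n. length (s i))"
    using * by (intro sum.mono_neutral_left) auto
  then show "(\<Sum>i | s i \<noteq> []. length (s i)) = d" using assms by (simp add: selections_def)
qed

lemma selection_chosen:
  assumes "s \<in> selections n E d" "X \<in> set (s i)"
  shows "X = {i} \<or> X \<in> E \<and> i \<in> X"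
  using selection_memberD(2)[OF assms] by (auto simp: choices_def)

lemma selection_balanced:
  assumes s: "s \<in> selections n E d" and w: "w < n"
    and nz: "trails n L w w (selection_arcs k s) \<noteq> 0" and v: "v < n"
  shows "in_deg n (selection_arcs k s) v = length (s v) * (k - 1)"
  using trails_nonzeroD[OF nz supported_selection[OF s] w] v out_deg_selection[OF s v]
  by (auto simp: balanced_def)

text \<open>An arc into \<open>j\<close> makes its in-degree positive; by balance \<open>j\<close>
  must then have a choice of its own.\<close>

lemma selection_closed:
  assumes s: "s \<in> selections n E d" and w: "w < n"
    and nz: "trails n L w w (selection_arcs k s) \<noteq> 0"
    and e: "e \<in> set (s i)" "e \<in> E"
  shows "e \<subseteq> {i. s i \<noteq> []}"
proof
  fix j assume j: "j \<in> e"
  have "s j \<noteq> []" if "j \<noteq> i"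
  proof -
    have "choice_arcs k i e j > 0" using that j by (simp add: choice_arcs_edge[OF e(2)])
    then have pos: "selection_arcs k s i j > 0" using e selection_arcs_pos_iff by blast
    then have ij: "i < n" "j < n" using supported_selection[OF s] by (auto simp: supported_def)
    have "selection_arcs k s i j \<le> in_deg n (selection_arcs k s) j"
      unfolding in_deg_def using ij by (intro member_le_sum) auto
    then show ?thesis using pos selection_balanced[OF s w nz ij(2)] by auto
  qed
  then show "j \<in> {i. s i \<noteq> []}" using e by (cases "j = i") auto
qed

text \<open>If all choices at \<open>v\<close> are loops, these loops already account for the whole
  in-degree that balance allows at \<open>v\<close>. No arc enters \<open>v\<close> from outside and
  none leaves, so the trail lives at \<open>v\<close> alone.\<close>

lemma selection_cases:
  assumes s: "s \<in> selections n E d" and w: "w < n"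
    and nz: "trails n L w w (selection_arcs k s) \<noteq> 0"
  obtains "s = loop_selection d w" | "\<And>v. s v \<noteq> [] \<Longrightarrow> \<exists>e\<in>set (s v). e \<in> E"
proof (cases "\<forall>v. s v \<noteq> [] \<longrightarrow> (\<exists>e\<in>set (s v). e \<in> E)")
  case True
  then show ?thesis using that(2) by blast
next
  case False
  then obtain v where v: "s v \<noteq> []" "\<And>X. X \<in> set (s v) \<Longrightarrow> X = {v}"
    using selection_chosen[OF s] by blast
  let ?m = "selection_arcs k s"
  have vn: "v < n" using selection_support(1)[OF s] v(1) by auto
  have out: "?m v j = 0" if "j \<noteq> v" for j
  proof -
    have "\<not> ?m v j > 0"
      unfolding selection_arcs_pos_iff using v(2) that by (auto simp: choice_arcs_def)
    then show ?thesis by simp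
  qed
  have loops: "?m v v = length (s v) * (k - 1)"
  proof -
    have "(\<Sum>j<n. ?m v j) = (\<Sum>j<n. if j = v then ?m v v else 0)" by (rule sum.cong) (auto simp: out)
    also have "\<dots> = ?m v v" using vn by simp
    finally show ?thesis using out_deg_selection[OF s vn] by (simp add: out_deg_def)
  qed
  have into: "?m i v = 0" if "i \<noteq> v" for i
  proof (cases "i < n")
    case True
    have "in_deg n ?m v = ?m v v + (\<Sum>i\<in>{..<n} - {v}. ?m i v)"
      unfolding in_deg_def using vn by (subst sum.remove[of _ v]) auto
    then have "(\<Sum>i\<in>{..<n} - {v}. ?m i v) = 0"
      using selection_balanced[OF s w nz vn] loops by simp
    then show ?thesis using True that by simp
  next
    case False
    then show ?thesis using supported_selection[OF s] by (auto simp: supported_def)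
  qed
  have "w = v"
  proof (rule ccontr)
    assume "w \<noteq> v"
    \<comment> \<open>The complement of \<open>v\<close> is closed under arcs because nothing enters
      \<open>v\<close>; a trail starting there would miss the loops at \<open>v\<close>.\<close>
    have "v \<in> - {v}"
    proof (rule trails_closed_set[OF nz])
      show "?m v v \<noteq> 0" using loops v(1) k by simp
      show "j \<in> - {v}" if "i \<in> - {v}" "?m i j \<noteq> 0" for i j using that into[of i] by (cases "j = v") auto
    qed (use \<open>w \<noteq> v\<close> in auto)
    then show False by simp
  qed
  have others: "s i = []" if "i \<noteq> v" for i
  proof (rule ccontr)
    assume "s i \<noteq> []"
    then have i: "i < n" using selection_support(1)[OF s] by auto
    then have "out_deg n ?m i \<noteq> 0" using out_deg_selection[OF s i] \<open>s i \<noteq> []\<close> k by simp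
    then obtain j where j: "?m i j \<noteq> 0"
      unfolding out_deg_def by (meson sum.not_neutral_contains_not_neutral)
    have "i \<in> {v}"
    proof (rule trails_closed_set[OF nz])
      show "j \<in> {v}" if "i \<in> {v}" "?m i j \<noteq> 0" for i j using that out[of j] by (cases "j = v") auto
    qed (use \<open>w = v\<close> j in auto)
    then show False using that by simp
  qed
  have "{i. s i \<noteq> []} = {v}" using v(1) others by auto
  then have "length (s v) = d" using selection_support(3)[OF s] by simp
  then have "s v = replicate d {v}" using v(2) by (intro replicate_eqI) auto
  then have "s = loop_selection d w"
    using others \<open>w = v\<close> by (auto simp: loop_selection_def)
  then show ?thesis using that(1) by blast
qed

lemma edge_in_support_eq:
  assumes s: "s \<in> selections n E d" and w: "w < n"
    and nz: "trails n L w w (selection_arcs k s) \<noteq> 0"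
    and c: "card {i. s i \<noteq> []} = k" and e: "e \<in> set (s i)" "e \<in> E"
  shows "e = {i. s i \<noteq> []}"
  by (rule card_subset_eq[OF selection_support(2)[OF s] selection_closed[OF s w nz e]])
    (simp add: c edgeD(2)[OF e(2)])

text \<open>A selected edge brings all of its \<open>k\<close> vertices into the support, and each
  vertex of the support uses up at least one of the \<open>d\<close> choices.\<close>

lemma card_support_bounds:
  assumes s: "s \<in> selections n E d" and d: "d > 0" and w: "w < n"
    and nz: "trails n L w w (selection_arcs k s) \<noteq> 0"
    and edges: "\<And>v. s v \<noteq> [] \<Longrightarrow> \<exists>e\<in>set (s v). e \<in> E"
  shows "k \<le> card {i. s i \<noteq> []}" "card {i. s i \<noteq> []} \<le> d"
proof -
  have "{i. s i \<noteq> []} \<noteq> {}"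
  proof
    assume "{i. s i \<noteq> []} = {}"
    then have "(\<Sum>i | s i \<noteq> []. length (s i)) = 0" by (simp only: sum.empty)
    then show False using selection_support(3)[OF s] d by simp
  qed
  then obtain v e where e: "e \<in> set (s v)" "e \<in> E" using edges by blast
  then show "k \<le> card {i. s i \<noteq> []}"
    using card_mono[OF selection_support(2)[OF s] selection_closed[OF s w nz e]] edgeD(2) by simp
  have "(\<Sum>i | s i \<noteq> []. 1) \<le> (\<Sum>i | s i \<noteq> []. length (s i))"
    by (rule sum_mono) (auto simp: Suc_le_eq)
  then show "card {i. s i \<noteq> []} \<le> d" using selection_support(3)[OF s] by simp
qed

text \<open>Counts the choices beyond the first at each vertex. For d \<le> k + 1 and a support of
  at least \<open>k\<close> vertices this excess is 0 or 1, which drives the case distinctions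
  below.\<close>

lemma support_excess:
  assumes s: "s \<in> selections n E d"
  shows "(\<Sum>i | s i \<noteq> []. length (s i) - 1) + card {i. s i \<noteq> []} = d"
proof -
  have "(\<Sum>i | s i \<noteq> []. length (s i) - 1) + (\<Sum>i | s i \<noteq> []. 1) = (\<Sum>i | s i \<noteq> []. length (s i))"
    unfolding sum.distrib[symmetric] by (rule sum.cong) (auto simp: Suc_le_eq)
  then show ?thesis using selection_support(3)[OF s] by simp
qed

lemma selection_small:
  assumes s: "s \<in> selections n E d" and d: "0 < d" "d < k" and w: "w < n"
    and nz: "trails n L w w (selection_arcs k s) \<noteq> 0"
  shows "s = loop_selection d w"
proof (cases rule: selection_cases[OF s w nz])
  case 2
  then show ?thesis using card_support_bounds[OF s d(1) w nz 2] d(2) by linarith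
qed

lemma selection_k:
  assumes s: "s \<in> selections n E k" and w: "w < n"
    and nz: "trails n L w w (selection_arcs k s) \<noteq> 0"
  shows "s = loop_selection k w \<or> (\<exists>e\<in>E. s = edge_selection e)"
proof (cases rule: selection_cases[OF s w nz])
  case 2
  let ?S = "{i. s i \<noteq> []}"
  have c: "card ?S = k" using card_support_bounds[OF s _ w nz 2] k by simp
  then have "\<forall>i\<in>?S. length (s i) - 1 = 0"
    using support_excess[OF s] selection_support(2)[OF s] by simp
  have eq: "s i = [?S] \<and> ?S \<in> E" if i: "s i \<noteq> []" for i
  proof -
    obtain e where e: "e \<in> set (s i)" "e \<in> E" using 2[OF i] by blast
    have "length (s i) = 1"
      using bspec[OF \<open>\<forall>i\<in>?S. length (s i) - 1 = 0\<close>, of i] i by (cases "s i") auto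
    then have "s i = [e]" using e by (auto simp: length_Suc_conv)
    then show ?thesis using edge_in_support_eq[OF s w nz c e] e by simp
  qed
  have "?S \<noteq> {}" using c k by (intro notI) simp
  then have "?S \<in> E" using eq by blast
  moreover have "s = edge_selection ?S" using eq by (auto simp: edge_selection_def)
  ultimately show ?thesis by blast
qed simp

text \<open>With \<open>k\<close> support vertices exactly one vertex has two choices, and the only
  edge available is the support itself. With k + 1 support vertices each has a single choice, an
  edge that omits one of them.\<close>

lemma selection_Suc_k:
  assumes s: "s \<in> selections n E (k + 1)" and w: "w < n"
    and nz: "trails n L w w (selection_arcs k s) \<noteq> 0"
  shows "s = loop_selection (k + 1) w \<or>
    (\<exists>e\<in>E. \<exists>v\<in>e. \<exists>b. s = edge_loop_selection e v b) \<or>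
    (\<exists>V\<in>clique_sets k n E. \<exists>f\<in>(\<Pi>\<^sub>E i\<in>V. V - {i}). s = clique_selection V f)"
proof (cases rule: selection_cases[OF s w nz])
  case 2
  let ?S = "{i. s i \<noteq> []}"
  note fin = selection_support(2)[OF s]
  have "card ?S = k \<or> card ?S = k + 1" using card_support_bounds[OF s _ w nz 2] k by auto
  then show ?thesis
  proof
    assume c: "card ?S = k"
    have "(\<Sum>i\<in>?S. length (s i) - 1) = Suc 0" using support_excess[OF s] c by simp
    then obtain v where v: "v \<in> ?S" "length (s v) - 1 = Suc 0"
      and others: "\<And>i. i \<in> ?S \<Longrightarrow> v \<noteq> i \<Longrightarrow> length (s i) - 1 = 0"
      using sum_eq_Suc0_iff[OF fin] by (metis (no_types, lifting))
    obtain e where e: "e \<in> set (s v)" "e \<in> E" using 2 v by blast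
    have eS: "e = ?S" using edge_in_support_eq[OF s w nz c e] .
    have si: "s i = [e]" if "i \<in> e" "i \<noteq> v" for i
    proof -
      have i: "s i \<noteq> []" using that eS by auto
      obtain e' where e': "e' \<in> set (s i)" "e' \<in> E" using 2[OF i] by blast
      have "length (s i) = 1" using others[of i] that i by (cases "s i") auto
      then have "s i = [e']" using e' by (auto simp: length_Suc_conv)
      then show ?thesis using edge_in_support_eq[OF s w nz c e'] eS by simp
    qed
    have ve: "v \<in> e" using v eS by simp
    have "length (s v) = 2" using v by simp
    then obtain a b where ab: "s v = [a, b]" by (auto simp: numeral_2_eq_2 length_Suc_conv)
    have ab_cases: "X = {v} \<or> X = e" if "X \<in> {a, b}" for X
      using selection_chosen[OF s, of X v] edge_in_support_eq[OF s w nz c, of X v] that ab eS by auto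
    \<comment> \<open>Balance excludes the double edge: \<open>v\<close> would receive k - 1 arcs,
      one from each other vertex of \<open>e\<close>, but emit 2 (k - 1).\<close>
    have "\<not> (a = e \<and> b = e)"
    proof
      assume "a = e \<and> b = e"
      then have sv: "s v = [e, e]" using ab by simp
      have vn: "v < n" using v selection_support(1)[OF s] by auto
      have "selection_arcs k s i v = of_bool (i \<in> e - {v})" for i
      proof (cases "i \<in> e")
        case True
        then show ?thesis
          using si[of i] sv by (cases "i = v") (auto simp: selection_arcs_def choice_arcs_edge[OF e(2)] ve)
      next
        case False
        then show ?thesis using eS by (auto simp: selection_arcs_def)
      qed
      then have "in_deg n (selection_arcs k s) v = (\<Sum>i<n. of_bool (i \<in> e - {v}))"
        by (simp add: in_deg_def)
      also have "\<dots> = card ({..<n} \<inter> {i. i \<in> e - {v}})" by (subst sum_of_bool_eq) auto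
      also have "{..<n} \<inter> {i. i \<in> e - {v}} = e - {v}" using edgeD(1)[OF e(2)] by auto
      finally have "in_deg n (selection_arcs k s) v = k - 1"
        using edgeD[OF e(2)] ve by (simp add: card_Diff_singleton)
      then show False using selection_balanced[OF s w nz vn] sv k by simp
    qed
    moreover have "a = e \<or> b = e" using e ab by auto
    ultimately have "s v = [e, {v}] \<or> s v = [{v}, e]" using ab_cases ab by auto
    then obtain b where b: "s v = (if b then [e, {v}] else [{v}, e])" by (metis (full_types))
    have "s = edge_loop_selection e v b"
    proof
      fix i
      consider "i = v" | "i \<noteq> v" "i \<in> e" | "i \<noteq> v" "s i = []" "i \<notin> e"
        using eS by blast
      then show "s i = edge_loop_selection e v b i"
        by cases (simp_all add: b si edge_loop_selection_def edge_selection_def)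
    qed
    then show ?thesis using e(2) ve by blast
  next
    assume c: "card ?S = k + 1"
    have "\<forall>i\<in>?S. length (s i) - 1 = 0" using support_excess[OF s] c fin by simp
    have single: "\<exists>x\<in>?S - {i}. s i = [?S - {x}] \<and> ?S - {x} \<in> E" if i: "i \<in> ?S" for i
    proof -
      obtain e where e: "e \<in> set (s i)" "e \<in> E" using 2 i by blast
      have "length (s i) = 1" using bspec[OF \<open>\<forall>i\<in>?S. length (s i) - 1 = 0\<close>, of i] i by (cases "s i") auto
      then have si: "s i = [e]" using e by (auto simp: length_Suc_conv)
      have sub: "e \<subseteq> ?S" using selection_closed[OF s w nz e] .
      have "card (?S - e) = 1"
        using card_Diff_subset[OF edgeD(3)[OF e(2)] sub] c edgeD(2)[OF e(2)] by simp
      then obtain x where x: "?S - e = {x}" by (auto simp: card_Suc_eq)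
      then have "e = ?S - {x}" using sub by blast
      moreover have "i \<in> e" using selection_chosen[OF s e(1)] e(2) loop_not_edge by auto
      ultimately show ?thesis using si e(2) x by (intro bexI[of _ x]) auto
    qed
    then obtain f where f: "\<And>i. i \<in> ?S \<Longrightarrow> f i \<in> ?S - {i} \<and> s i = [?S - {f i}] \<and> ?S - {f i} \<in> E"
      by metis
    let ?f = "restrict f ?S"
    \<comment> \<open>A vertex that no selected edge omits would receive \<open>k\<close> arcs and
      emit only k - 1. Hence every vertex is omitted by some selected edge, and all k-subsets of the
      support are edges.\<close>
    have onto: "?S - {x} \<in> E" if x: "x \<in> ?S" for x
    proof (rule ccontr)
      assume no: "?S - {x} \<notin> E"
      have xn: "x < n" using x selection_support(1)[OF s] by auto
      have "selection_arcs k s i x = of_bool (i \<in> ?S - {x})" for i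
      proof (cases "i \<in> ?S")
        case True
        then have "f i \<noteq> x" using f no by blast
        then show ?thesis
          using f[OF True] x True by (auto simp: selection_arcs_def choice_arcs_edge)
      next
        case False
        then show ?thesis by (auto simp: selection_arcs_def)
      qed
      then have "in_deg n (selection_arcs k s) x = (\<Sum>i<n. of_bool (i \<in> ?S - {x}))"
        by (simp add: in_deg_def)
      also have "\<dots> = card ({..<n} \<inter> {i. i \<in> ?S - {x}})" by (subst sum_of_bool_eq) auto
      also have "{..<n} \<inter> {i. i \<in> ?S - {x}} = ?S - {x}" using selection_support(1)[OF s] by auto
      also have "card (?S - {x}) = k" using c x fin by (subst card_Diff_singleton) auto
      finally have "in_deg n (selection_arcs k s) x = k" .
      moreover have "length (s x) = 1" using f[OF x] by (metis One_nat_def length_Cons list.size(3))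
      ultimately show False using selection_balanced[OF s w nz xn] k by simp
    qed
    have "e \<in> E" if "e \<subseteq> ?S" "card e = k" for e
    proof -
      have "finite e" using that(1) fin finite_subset by blast
      then have "card (?S - e) = 1" using card_Diff_subset[OF _ that(1)] c that(2) by simp
      then obtain x where x: "?S - e = {x}" by (auto simp: card_Suc_eq)
      then have "e = ?S - {x}" "x \<in> ?S" using that(1) by blast+
      then show ?thesis using onto by simp
    qed
    then have "?S \<in> clique_sets k n E"
      unfolding clique_sets_def using c selection_support(1)[OF s] by simp
    moreover have "?f \<in> (\<Pi>\<^sub>E i\<in>?S. ?S - {i})" using f by auto
    moreover have "s = clique_selection ?S ?f"
    proof
      fix i
      show "s i = clique_selection ?S ?f i"
        using f[of i] by (cases "s i = []") (simp_all add: clique_selection_def)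
    qed
    ultimately show ?thesis by blast
  qed
qed simp

end

section \<open>Contributions of the selections\<close>

lemma trails_isolated:
  assumes "supported n m" "w < n" "out_deg n m w = 0" "L > 0"
  shows "trails n L w w m = 0"
  using assms by (cases L) (auto simp: out_deg_def)

text \<open>Writing the root factorial as out-degree times the factorial of its predecessor makes
  all roots alike up to their out-degrees, which add up to \<open>L\<close>. The common value
  \<open>t\<close> is needed only at vertices that have outgoing arcs.\<close>

lemma closed_trails_sum:
  assumes sup: "supported n m" and bal: "\<And>v. v < n \<Longrightarrow> in_deg n m v = out_deg n m v"
    and L: "(\<Sum>v<n. out_deg n m v) = L" "L > 0"
    and t: "\<And>w. w < n \<Longrightarrow> out_deg n m w > 0 \<Longrightarrow> fdet n (laplacian n m w) = t"
  shows "(\<Sum>w<n. trails n L w w m) = real L * t * (\<Prod>v<n. fact (out_deg n m v - 1))"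
proof -
  have "trails n L w w m = real (out_deg n m w) * (t * (\<Prod>v<n. fact (out_deg n m v - 1)))"
    if w: "w < n" for w
  proof (cases "out_deg n m w = 0")
    case True
    then show ?thesis using trails_isolated[OF sup w True L(2)] by simp
  next
    case False
    have "balanced n m w w" using bal by (simp add: balanced_def)
    then have "trails n L w w m =
        fact (out_deg n m w) * (\<Prod>v\<in>{..<n} - {w}. fact (out_deg n m v - 1)) * t"
      using trails_eq_det[OF sup w w _ L(1)] t[OF w] False by simp
    also have "fact (out_deg n m w) = real (out_deg n m w) * fact (out_deg n m w - 1)"
      using False by (simp add: fact_reduce)
    also have "(\<Prod>v<n. fact (out_deg n m v - 1)) =
        fact (out_deg n m w - 1) * (\<Prod>v\<in>{..<n} - {w}. fact (out_deg n m v - 1) :: real)"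
      using w by (intro prod.remove) auto
    ultimately show ?thesis by simp
  qed
  then have "(\<Sum>w<n. trails n L w w m) =
      (\<Sum>w<n. real (out_deg n m w) * (t * (\<Prod>v<n. fact (out_deg n m v - 1))))"
    by (intro sum.cong) auto
  also have "\<dots> = real (\<Sum>w<n. out_deg n m w) * (t * (\<Prod>v<n. fact (out_deg n m v - 1)))"
    by (simp add: sum_distrib_right)
  finally show ?thesis unfolding L(1) by simp
qed

context uniform_hypergraph_on
begin

text \<open>The operators contribute 1 / l! and the trails (l - 1)! at a vertex emitting l arcs, so
  the quotient 1 / l remains.\<close>

lemma selection_term_eq:
  assumes s: "s \<in> selections n E d" and d: "d > 0"
    and bal: "\<And>v. v < n \<Longrightarrow> in_deg n (selection_arcs k s) v = length (s v) * (k - 1)"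
    and t: "\<And>w. s w \<noteq> [] \<Longrightarrow> fdet n (laplacian n (selection_arcs k s) w) = t"
  shows "selection_term k n E \<alpha> d s = real d * (real k - 1) * t *
    (\<Prod>i | s i \<noteq> []. prod_list (map (choice_weight \<alpha> E i) (s i)) / (real (length (s i)) * (real k - 1)))"
proof -
  let ?W = "\<lambda>i. prod_list (map (choice_weight \<alpha> E i) (s i))"
  let ?l = "\<lambda>i. length (s i) * (k - 1)"
  have out: "out_deg n (selection_arcs k s) v = ?l v" if "v < n" for v
    using out_deg_selection[OF s that] .
  have "(\<Sum>v<n. out_deg n (selection_arcs k s) v) = (\<Sum>v<n. length (s v)) * (k - 1)"
    unfolding sum_distrib_right by (rule sum.cong) (auto simp: out)
  then have "(\<Sum>v<n. out_deg n (selection_arcs k s) v) = d * (k - 1)"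
    using s by (simp add: selections_def)
  then have "(\<Sum>w<n. trails n (d * (k - 1)) w w (selection_arcs k s)) =
      real (d * (k - 1)) * t * (\<Prod>v<n. fact (out_deg n (selection_arcs k s) v - 1))"
    using d k bal out t by (intro closed_trails_sum supported_selection[OF s]) auto
  also have "(\<Prod>v<n. fact (out_deg n (selection_arcs k s) v - 1)) = (\<Prod>v<n. fact (?l v - 1) :: real)"
    by (rule prod.cong) (auto simp: out)
  finally have "selection_term k n E \<alpha> d s = real (d * (k - 1)) * t *
      ((\<Prod>i<n. ?W i / fact (?l i)) * (\<Prod>i<n. fact (?l i - 1)))"
    by (simp add: selection_term_def)
  also have "(\<Prod>i<n. ?W i / fact (?l i)) * (\<Prod>i<n. fact (?l i - 1)) =
      (\<Prod>i<n. ?W i / fact (?l i) * fact (?l i - 1))"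
    by (simp only: prod.distrib)
  also have "\<dots> = (\<Prod>i | s i \<noteq> []. ?W i / (real (length (s i)) * (real k - 1)))"
  proof (rule prod.mono_neutral_cong_right)
    \<comment> \<open>Off the support both factorials are 0!, the truncated \<open>0 - 1\<close>
      included, and the empty product of weights is 1.\<close>
    show "\<forall>i\<in>{..<n} - {i. s i \<noteq> []}. ?W i / fact (?l i) * fact (?l i - 1) = 1" by auto
    fix i assume "i \<in> {i. s i \<noteq> []}"
    then have "?l i > 0" using k by simp
    then have "fact (?l i) = real (?l i) * fact (?l i - 1)" by (simp add: fact_reduce)
    moreover have "real (?l i) = real (length (s i)) * (real k - 1)" using k by (simp add: of_nat_diff)
    ultimately show "?W i / fact (?l i) * fact (?l i - 1) = ?W i / (real (length (s i)) * (real k - 1))"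
      by simp
  qed (use selection_support(1)[OF s] in auto)
  finally show ?thesis using k by (simp add: of_nat_diff)
qed

section \<open>Contributions of loops, of edges, and of edges with a loop\<close>

lemma loop_selection_mem:
  assumes "v < n"
  shows "loop_selection d v \<in> selections n E d"
proof -
  have "(\<Sum>i<n. length (loop_selection d v i)) = (\<Sum>i<n. if i = v then d else 0)"
    by (rule sum.cong) (auto simp: loop_selection_def)
  then show ?thesis using assms by (auto simp: selections_def loop_selection_def choices_def)
qed

lemma loop_selection_support: "d > 0 \<Longrightarrow> {i. loop_selection d v i \<noteq> []} = {v}"
  by (auto simp: loop_selection_def)

text \<open>All rows of the Laplacian are unit vectors: \<open>v\<close> is the root and no other
  vertex has arcs. The factor d (k - 1) for the starts cancels the denominator at
  \<open>v\<close>.\<close>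

lemma loop_selection_term:
  assumes v: "v < n" and d: "d > 0"
  shows "selection_term k n E \<alpha> d (loop_selection d v) = (\<alpha> * real (vertex_degree E v)) ^ d"
proof -
  let ?s = "loop_selection d v"
  have arcs: "selection_arcs k ?s i j = (if i = v \<and> j = v then d * (k - 1) else 0)" for i j
    by (auto simp: selection_arcs_def loop_selection_def choice_arcs_def map_replicate_const sum_list_replicate)
  have inn: "in_deg n (selection_arcs k ?s) u = length (?s u) * (k - 1)" if "u < n" for u
  proof -
    have "in_deg n (selection_arcs k ?s) u = (\<Sum>i<n. if i = v then of_bool (u = v) * (d * (k - 1)) else 0)"
      unfolding in_deg_def by (rule sum.cong) (auto simp: arcs)
    then show ?thesis using v by (auto simp: loop_selection_def)
  qed
  have lap: "fdet n (laplacian n (selection_arcs k ?s) w) = 1" if "?s w \<noteq> []" for w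
  proof -
    have w: "w = v" using that by (auto simp: loop_selection_def split: if_splits)
    have "fdet n (laplacian n (selection_arcs k ?s) w) = fdet n (\<lambda>i j. of_bool (i = j))"
      by (rule fdet_cong) (auto simp: laplacian_def w out_deg_def arcs)
    then show ?thesis using fdet_identity by simp
  qed
  have "selection_term k n E \<alpha> d ?s = real d * (real k - 1) * 1 *
    (\<Prod>i | ?s i \<noteq> []. prod_list (map (choice_weight \<alpha> E i) (?s i)) / (real (length (?s i)) * (real k - 1)))"
    by (rule selection_term_eq[OF loop_selection_mem[OF v] d inn lap])
  also have "\<dots> = (\<alpha> * real (vertex_degree E v)) ^ d"
    unfolding loop_selection_support[OF d] using d k
    by (simp add: loop_selection_def choice_weight_def map_replicate_const prod_list_replicate)
  finally show ?thesis .
qed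

text \<open>The \<open>c i\<close> loops at \<open>i\<close> enter both the out-degree and the
  diagonal multiplicity and cancel in the Laplacian. One computation thus serves an edge with and
  without added loops.\<close>

lemma complete_arcs:
  assumes e: "e \<in> E"
    and m: "\<And>i j. m i j = (if i \<in> e then of_bool (j \<in> e - {i}) + (if j = i then c i else 0) else 0)"
  shows "i < n \<Longrightarrow> in_deg n m i = (if i \<in> e then k - 1 + c i else 0)"
    and "w \<in> e \<Longrightarrow> fdet n (laplacian n m w) = real k ^ (k - 2)"
proof -
  have sumk: "(\<Sum>j<n. of_bool (j \<in> e - {i})) = k - 1" if "i \<in> e" for i
  proof -
    have "(\<Sum>j<n. of_bool (j \<in> e - {i})) = card ({..<n} \<inter> {j. j \<in> e - {i}})"
      by (subst sum_of_bool_eq) auto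
    also have "{..<n} \<inter> {j. j \<in> e - {i}} = e - {i}" using edgeD(1)[OF e] by auto
    finally show ?thesis using that edgeD[OF e] by (simp add: card_Diff_singleton)
  qed
  show "in_deg n m i = (if i \<in> e then k - 1 + c i else 0)" if "i < n"
  proof (cases "i \<in> e")
    case True
    have "in_deg n m i = (\<Sum>j<n. of_bool (j \<in> e - {i}) + (if j = i then c i else 0))"
      unfolding in_deg_def using True by (intro sum.cong) (auto simp: m)
    then show ?thesis using that True sumk[OF True] by (simp add: sum.distrib)
  next
    case False
    then show ?thesis by (auto simp: in_deg_def m)
  qed
  have out: "out_deg n m i = (if i \<in> e then k - 1 + c i else 0)" if "i < n" for i
    using that sumk[of i] by (cases "i \<in> e") (simp_all add: out_deg_def m sum.distrib)
  show "fdet n (laplacian n m w) = real k ^ (k - 2)" if w: "w \<in> e"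
  proof -
    have "fdet n (laplacian n m w) = fdet n (\<lambda>i j. if i \<in> e - {w}
        then real k * of_bool (i = j) - of_bool (j \<in> e) else of_bool (i = j))"
    proof (rule fdet_cong)
      fix i j assume "i < n" "j < n"
      then show "laplacian n m w i j = (if i \<in> e - {w}
        then real k * of_bool (i = j) - of_bool (j \<in> e) else of_bool (i = j))"
        using k by (auto simp: laplacian_def out m of_nat_diff)
    qed
    also have "\<dots> = real k ^ card (e - {w}) * (1 - real (card (e - {w})) / real k)"
      using edgeD[OF e] k by (intro fdet_complete) auto
    also have "card (e - {w}) = k - 1" using w edgeD[OF e] by (simp add: card_Diff_singleton)
    also have "real k ^ (k - 1) * (1 - real (k - 1) / real k) = real k ^ (k - 2)"
    proof -
      have "k - 1 = Suc (k - 2)" using k by simp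
      then have "real k ^ (k - 1) = real k * real k ^ (k - 2)" by (metis power_Suc)
      moreover have "1 - real (k - 1) / real k = 1 / real k" using k by (simp add: of_nat_diff field_simps)
      ultimately show ?thesis using k by simp
    qed
    finally show ?thesis .
  qed
qed

lemma edge_selection_mem:
  assumes e: "e \<in> E"
  shows "edge_selection e \<in> selections n E k"
proof -
  have "(\<Sum>i<n. length (edge_selection e i)) = (\<Sum>i\<in>e. 1)"
    using edgeD[OF e] by (intro sum.mono_neutral_cong_right) (auto simp: edge_selection_def)
  then show ?thesis
    using e edgeD[OF e] by (auto simp: selections_def edge_selection_def choices_def)
qed

lemma edge_selection_support: "{i. edge_selection e i \<noteq> []} = e"
  by (auto simp: edge_selection_def)

lemma edge_selection_term:
  assumes e: "e \<in> E"
  shows "selection_term k n E \<alpha> k (edge_selection e) =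
    real k ^ (k - 1) * (1 - \<alpha>) ^ k / (real k - 1) ^ (k - 1)"
proof -
  let ?s = "edge_selection e"
  have arcs: "selection_arcs k ?s i j =
      (if i \<in> e then of_bool (j \<in> e - {i}) + (if j = i then 0 else 0) else 0)" for i j
    by (auto simp: selection_arcs_def edge_selection_def choice_arcs_edge[OF e])
  have inn: "in_deg n (selection_arcs k ?s) u = length (?s u) * (k - 1)" if "u < n" for u
    using complete_arcs(1)[OF e arcs that] by (auto simp: edge_selection_def)
  have lap: "fdet n (laplacian n (selection_arcs k ?s) w) = real k ^ (k - 2)" if "?s w \<noteq> []" for w
    using complete_arcs(2)[OF e arcs, of w] that by (auto simp: edge_selection_def split: if_splits)
  have "selection_term k n E \<alpha> k ?s = real k * (real k - 1) * real k ^ (k - 2) *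
    (\<Prod>i | ?s i \<noteq> []. prod_list (map (choice_weight \<alpha> E i) (?s i)) / (real (length (?s i)) * (real k - 1)))"
    using k by (intro selection_term_eq[OF edge_selection_mem[OF e] _ inn lap]) auto
  also have "(\<Prod>i | ?s i \<noteq> []. prod_list (map (choice_weight \<alpha> E i) (?s i)) / (real (length (?s i)) * (real k - 1)))
     = (\<Prod>i\<in>e. (1 - \<alpha>) / (real k - 1))"
    unfolding edge_selection_support using e loop_not_edge
    by (intro prod.cong) (auto simp: edge_selection_def choice_weight_def)
  also have "\<dots> = ((1 - \<alpha>) / (real k - 1)) ^ k" using edgeD[OF e] by simp
  also have "real k * (real k - 1) * real k ^ (k - 2) * ((1 - \<alpha>) / (real k - 1)) ^ k =
     real k ^ (k - 1) * (1 - \<alpha>) ^ k / (real k - 1) ^ (k - 1)"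
  proof -
    have "real k * real k ^ (k - 2) = real k ^ (k - 1)"
      using k by (metis Suc_diff_le Suc_1 diff_Suc_Suc power_Suc)
    moreover have "(real k - 1) ^ k = (real k - 1) * (real k - 1) ^ (k - 1)"
      using k by (cases k) auto
    moreover have "real k * (real k - 1) * real k ^ (k - 2) * ((1 - \<alpha>) / (real k - 1)) ^ k =
        real k * real k ^ (k - 2) * (1 - \<alpha>) ^ k * ((real k - 1) / (real k - 1) ^ k)"
      by (simp add: power_divide)
    ultimately show ?thesis using k by simp
  qed
  finally show ?thesis .
qed

lemma edge_loop_selection_mem:
  assumes e: "e \<in> E" and v: "v \<in> e"
  shows "edge_loop_selection e v b \<in> selections n E (k + 1)"
proof -
  have "(\<Sum>i<n. length (edge_loop_selection e v b i)) = (\<Sum>i\<in>e. 1 + of_bool (i = v))"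
    using edgeD[OF e] v
    by (intro sum.mono_neutral_cong_right) (auto simp: edge_loop_selection_def edge_selection_def)
  also have "\<dots> = k + 1"
    unfolding sum.distrib of_bool_def using edgeD[OF e] v by simp
  finally show ?thesis
    using e v edgeD[OF e]
    by (auto simp: selections_def edge_loop_selection_def edge_selection_def choices_def)
qed

lemma edge_loop_selection_support:
  "v \<in> e \<Longrightarrow> {i. edge_loop_selection e v b i \<noteq> []} = e"
  by (auto simp: edge_loop_selection_def edge_selection_def)

text \<open>The denominator 2 is the number of choices at \<open>v\<close>; it is compensated later
  by the two orders of these choices.\<close>

lemma edge_loop_selection_term:
  assumes e: "e \<in> E" and v: "v \<in> e"
  shows "selection_term k n E \<alpha> (k + 1) (edge_loop_selection e v b) =
    real (k + 1) * real k ^ (k - 2) * \<alpha> * (1 - \<alpha>) ^ k * real (vertex_degree E v) /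
      (2 * (real k - 1) ^ (k - 1))"
proof -
  let ?s = "edge_loop_selection e v b"
  have ne: "e \<noteq> {v}" using e loop_not_edge by auto
  have arcs: "selection_arcs k ?s i j =
      (if i \<in> e then of_bool (j \<in> e - {i}) + (if j = i then of_bool (i = v) * (k - 1) else 0) else 0)" for i j
    using v ne by (auto simp: selection_arcs_def edge_loop_selection_def edge_selection_def
        choice_arcs_edge[OF e] choice_arcs_def[of _ _ "{v}"])
  have inn: "in_deg n (selection_arcs k ?s) u = length (?s u) * (k - 1)" if "u < n" for u
    using complete_arcs(1)[OF e arcs that] v
    by (auto simp: edge_loop_selection_def edge_selection_def)
  have lap: "fdet n (laplacian n (selection_arcs k ?s) w) = real k ^ (k - 2)" if "?s w \<noteq> []" for w
    using complete_arcs(2)[OF e arcs, of w] that edge_loop_selection_support[OF v, of b] by blast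
  have "selection_term k n E \<alpha> (k + 1) ?s = real (k + 1) * (real k - 1) * real k ^ (k - 2) *
    (\<Prod>i | ?s i \<noteq> []. prod_list (map (choice_weight \<alpha> E i) (?s i)) / (real (length (?s i)) * (real k - 1)))"
    using k by (intro selection_term_eq[OF edge_loop_selection_mem[OF e v] _ inn lap]) auto
  also have "(\<Prod>i | ?s i \<noteq> []. prod_list (map (choice_weight \<alpha> E i) (?s i)) / (real (length (?s i)) * (real k - 1)))
     = (\<Prod>i\<in>e. prod_list (map (choice_weight \<alpha> E i) (?s i)) / (real (length (?s i)) * (real k - 1)))"
    by (simp only: edge_loop_selection_support[OF v])
  also have "\<dots> = prod_list (map (choice_weight \<alpha> E v) (?s v)) / (real (length (?s v)) * (real k - 1)) *
      (\<Prod>i\<in>e - {v}. prod_list (map (choice_weight \<alpha> E i) (?s i)) / (real (length (?s i)) * (real k - 1)))"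
    using v edgeD[OF e] by (intro prod.remove) auto
  also have "prod_list (map (choice_weight \<alpha> E v) (?s v)) / (real (length (?s v)) * (real k - 1)) =
      \<alpha> * real (vertex_degree E v) * (1 - \<alpha>) / (2 * (real k - 1))"
    using ne by (auto simp: edge_loop_selection_def choice_weight_def)
  also have "(\<Prod>i\<in>e - {v}. prod_list (map (choice_weight \<alpha> E i) (?s i)) / (real (length (?s i)) * (real k - 1)))
    = (\<Prod>i\<in>e - {v}. (1 - \<alpha>) / (real k - 1))"
    using e loop_not_edge
    by (intro prod.cong) (auto simp: edge_loop_selection_def edge_selection_def choice_weight_def)
  also have "\<dots> = ((1 - \<alpha>) / (real k - 1)) ^ (k - 1)"
    using edgeD[OF e] v by (simp add: card_Diff_singleton)
  also have "real (k + 1) * (real k - 1) * real k ^ (k - 2) *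
      (\<alpha> * real (vertex_degree E v) * (1 - \<alpha>) / (2 * (real k - 1)) * ((1 - \<alpha>) / (real k - 1)) ^ (k - 1)) =
    real (k + 1) * real k ^ (k - 2) * \<alpha> * (1 - \<alpha>) ^ k * real (vertex_degree E v) /
      (2 * (real k - 1) ^ (k - 1))"
  proof -
    have "(1 - \<alpha>) ^ k = (1 - \<alpha>) * (1 - \<alpha>) ^ (k - 1)"
      using k by (cases k) auto
    then have "a * x * c * (\<alpha> * b * (1 - \<alpha>) / (2 * x) * ((1 - \<alpha>) / x) ^ (k - 1)) =
        a * c * \<alpha> * (1 - \<alpha>) ^ k * b / (2 * x ^ (k - 1))" if "x \<noteq> 0" for a b c x :: real
      using that by (simp add: power_divide)
    then show ?thesis by this (use k in simp)
  qed
  finally show ?thesis .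
qed

end

section \<open>The clique contribution and its independence of the clique\<close>

lemma clique_selection_arcs:
  assumes "k \<ge> 2" "card V = Suc k" "f \<in> (\<Pi>\<^sub>E i\<in>V. V - {i})"
  shows "selection_arcs k (clique_selection V f) i j = of_bool (i \<in> V \<and> j \<in> V \<and> j \<noteq> f i \<and> j \<noteq> i)"
proof (cases "i \<in> V")
  case True
  have "card (V - {f i}) = k" using assms True by (subst card_Diff_singleton) auto
  moreover have "card {i} \<noteq> k" using assms(1) by simp
  ultimately have "V - {f i} \<noteq> {i}" by metis
  then show ?thesis using True by (auto simp: selection_arcs_def clique_selection_def choice_arcs_def)
qed (simp add: selection_arcs_def clique_selection_def)

definition clique_trails :: "nat \<Rightarrow> nat \<Rightarrow> nat set \<Rightarrow> real" where
  "clique_trails k n V = (\<Sum>f\<in>(\<Pi>\<^sub>E i\<in>V. V - {i}).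
     \<Sum>w<n. trails n ((k + 1) * (k - 1)) w w (selection_arcs k (clique_selection V f)))"

text \<open>A bijection \<open>h\<close> from \<open>V\<close> onto the standard set acts on the
  maps \<open>f\<close> by conjugation and carries the arcs of \<open>f\<close> to those of its
  conjugate.\<close>

lemma clique_trails_invariant:
  assumes k: "k \<ge> 2" and V: "V \<subseteq> {..<n}" "card V = Suc k"
  shows "clique_trails k n V = clique_trails k (Suc k) {..k}"
proof -
  let ?L = "(k + 1) * (k - 1)"
  let ?U = "{..k}"
  have finV: "finite V" using V finite_subset by blast
  obtain h where h: "bij_betw h V ?U"
    using finite_same_card_bij[OF finV, of ?U] V by auto
  define g where "g = inv_into V h"
  have g: "bij_betw g ?U V" unfolding g_def by (rule bij_betw_inv_into[OF h])
  have gh: "g (h i) = i" if "i \<in> V" for i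
    unfolding g_def using that h by (simp add: bij_betw_def)
  have hg: "h (g i) = i" if "i \<in> ?U" for i
    unfolding g_def using that h by (simp add: bij_betw_inv_into_right)
  have hV: "h i \<in> ?U" if "i \<in> V" for i using bij_betwE[OF h] that by blast
  have gU: "g i \<in> V" if "i \<in> ?U" for i using bij_betwE[OF g] that by blast
  have restrict_V: "(\<Sum>w<n. trails n ?L w w (selection_arcs k (clique_selection W f))) =
      (\<Sum>w\<in>W. trails n ?L w w (selection_arcs k (clique_selection W f)))"
    if "W \<subseteq> {..<n}" for W n f
  proof (rule sum.mono_neutral_right)
    \<comment> \<open>For k \<ge> 2 the trails have positive length, so a start without outgoing
      arcs contributes nothing.\<close>
    have "?L = Suc (?L - 1)" using k by simp
    moreover have "trails n (Suc l) w w (selection_arcs k (clique_selection W f)) = 0" if "w \<notin> W" for w l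
      using that by (simp add: selection_arcs_def clique_selection_def)
    ultimately show "\<forall>w\<in>{..<n} - W. trails n ?L w w (selection_arcs k (clique_selection W f)) = 0"
      by (metis DiffD2)
  qed (use that in auto)
  \<comment> \<open>Conjugation by \<open>h\<close> and its inverse, restricted so that the results
    remain extensional.\<close>
  let ?j = "\<lambda>f. \<lambda>i\<in>?U. h (f (g i))"
  let ?i = "\<lambda>f. \<lambda>i\<in>V. g (f (h i))"
  have j_mem: "?j f \<in> (\<Pi>\<^sub>E i\<in>?U. ?U - {i})" if f: "f \<in> (\<Pi>\<^sub>E i\<in>V. V - {i})" for f
  proof (rule PiE_I)
    fix i assume i: "i \<in> ?U"
    have fgi: "f (g i) \<in> V" "f (g i) \<noteq> g i" using f gU[OF i] by auto
    then have "h (f (g i)) \<noteq> h (g i)" using gh gU[OF i] by metis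
    then show "?j f i \<in> ?U - {i}" using i fgi hV hg[OF i] by simp
  qed auto
  have i_mem: "?i f \<in> (\<Pi>\<^sub>E i\<in>V. V - {i})" if f: "f \<in> (\<Pi>\<^sub>E i\<in>?U. ?U - {i})" for f
  proof (rule PiE_I)
    fix i assume i: "i \<in> V"
    have fhi: "f (h i) \<in> ?U" "f (h i) \<noteq> h i" using f hV[OF i] by auto
    then have "g (f (h i)) \<noteq> g (h i)" using hg hV[OF i] by metis
    then show "?i f i \<in> V - {i}" using i fhi gU gh[OF i] by simp
  qed auto
  show ?thesis
    unfolding clique_trails_def
  proof (rule sum.reindex_bij_witness[where i = ?i and j = ?j])
    fix f assume f: "f \<in> (\<Pi>\<^sub>E i\<in>V. V - {i})"
    show "?j f \<in> (\<Pi>\<^sub>E i\<in>?U. ?U - {i})" using j_mem[OF f] .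
    show "?i (?j f) = f"
    proof (rule PiE_ext[OF i_mem[OF j_mem[OF f]] f])
      fix i assume i: "i \<in> V"
      then have "f i \<in> V" using f by auto
      then show "?i (?j f) i = f i" using i hV[OF i] by (simp add: gh)
    qed
    let ?m = "selection_arcs k (clique_selection V f)"
    let ?m' = "selection_arcs k (clique_selection ?U (?j f))"
    have m: "?m i j = of_bool (i \<in> V \<and> j \<in> V \<and> j \<noteq> f i \<and> j \<noteq> i)" for i j
      using clique_selection_arcs[OF k V(2) f] .
    have m': "?m' i j = of_bool (i \<in> ?U \<and> j \<in> ?U \<and> j \<noteq> ?j f i \<and> j \<noteq> i)" for i j
      using clique_selection_arcs[OF k _ j_mem[OF f]] by simp
    have rel: "trails n ?L w w ?m = trails (Suc k) ?L (h w) (h w) ?m'" if w: "w \<in> V" for w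
    proof (rule trails_relabel[where V = V])
      show "inj_on h V" using h by (simp add: bij_betw_def)
      show "h ` V \<subseteq> {..<Suc k}" using hV by (auto simp: less_Suc_eq_le)
      show "i \<in> V \<and> j \<in> V" if "?m i j \<noteq> 0" for i j using that unfolding m by (auto split: if_splits)
      show "i \<in> h ` V \<and> j \<in> h ` V" if "?m' i j \<noteq> 0" for i j
      proof -
        have "h ` V = ?U" using h by (simp add: bij_betw_def)
        then show ?thesis using that unfolding m' by (auto split: if_splits)
      qed
      show "?m' (h i) (h j) = ?m i j" if ij: "i \<in> V" "j \<in> V" for i j
      proof -
        have "f i \<in> V" using f ij by auto
        then have "h j = h (f i) \<longleftrightarrow> j = f i" "h j = h i \<longleftrightarrow> j = i" using gh ij by metis+
        moreover have "?j f (h i) = h (f i)" using hV[OF ij(1)] gh[OF ij(1)] by simp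
        ultimately show ?thesis unfolding m m' using hV ij by simp
      qed
    qed (use V w in auto)
    have "(\<Sum>w<n. trails n ?L w w ?m) = (\<Sum>w\<in>V. trails (Suc k) ?L (h w) (h w) ?m')"
      unfolding restrict_V[OF V(1)] by (intro sum.cong refl rel)
    also have "\<dots> = (\<Sum>w\<in>?U. trails (Suc k) ?L w w ?m')"
      by (rule sum.reindex_bij_betw[OF h])
    also have "\<dots> = (\<Sum>w<Suc k. trails (Suc k) ?L w w ?m')"
      by (rule sum.cong) auto
    finally show "(\<Sum>w<Suc k. trails (Suc k) ?L w w ?m') = (\<Sum>w<n. trails n ?L w w ?m)" by simp
  next
    fix f assume f: "f \<in> (\<Pi>\<^sub>E i\<in>?U. ?U - {i})"
    show "?i f \<in> (\<Pi>\<^sub>E i\<in>V. V - {i})" using i_mem[OF f] .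
    show "?j (?i f) = f"
    proof (rule PiE_ext[OF j_mem[OF i_mem[OF f]] f])
      fix i assume i: "i \<in> ?U"
      then have "f i \<in> ?U" using f by auto
      then show "?j (?i f) i = f i" using i gU[OF i] by (simp add: hg)
    qed
  qed
qed

context uniform_hypergraph_on
begin

lemma clique_selection_mem:
  assumes V: "V \<in> clique_sets k n E" and f: "f \<in> (\<Pi>\<^sub>E i\<in>V. V - {i})"
  shows "clique_selection V f \<in> selections n E (k + 1)"
proof -
  have Vn: "V \<subseteq> {..<n}" "card V = Suc k" using V by (auto simp: clique_sets_def)
  have "(\<Sum>i<n. length (clique_selection V f i)) = (\<Sum>i\<in>V. 1)"
    using Vn by (intro sum.mono_neutral_cong_right) (auto simp: clique_selection_def)
  moreover have "V - {f i} \<in> E \<and> i \<in> V - {f i}" if "i \<in> V" for i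
  proof -
    have "f i \<in> V" "f i \<noteq> i" using f that by auto
    then have "card (V - {f i}) = k" using Vn by (subst card_Diff_singleton) auto
    then show ?thesis using V that \<open>f i \<noteq> i\<close> by (auto simp: clique_sets_def)
  qed
  ultimately show ?thesis
    using Vn by (auto simp: selections_def clique_selection_def choices_def)
qed

text \<open>One choice per vertex gives the operator factorial (k - 1)! at each of the k + 1
  vertices; the trail count is kept as it is.\<close>

lemma clique_selection_term:
  assumes V: "V \<in> clique_sets k n E" and f: "f \<in> (\<Pi>\<^sub>E i\<in>V. V - {i})"
  shows "selection_term k n E \<alpha> (k + 1) (clique_selection V f) =
    ((1 - \<alpha>) / fact (k - 1)) ^ (k + 1) *
    (\<Sum>w<n. trails n ((k + 1) * (k - 1)) w w (selection_arcs k (clique_selection V f)))"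
proof -
  have Vn: "V \<subseteq> {..<n}" "card V = Suc k" using V by (auto simp: clique_sets_def)
  have "(\<Prod>i<n. prod_list (map (choice_weight \<alpha> E i) (clique_selection V f i)) /
        fact (length (clique_selection V f i) * (k - 1))) = (\<Prod>i\<in>V. (1 - \<alpha>) / fact (k - 1))"
  proof (rule prod.mono_neutral_cong_right)
    fix i assume i: "i \<in> V"
    have "f i \<in> V" "f i \<noteq> i" using f i by auto
    then have "card (V - {f i}) = k" using Vn by (subst card_Diff_singleton) auto
    moreover have "card {i} \<noteq> k" using k by simp
    ultimately have "V - {f i} \<noteq> {i}" by metis
    then show "prod_list (map (choice_weight \<alpha> E i) (clique_selection V f i)) /
        fact (length (clique_selection V f i) * (k - 1)) = (1 - \<alpha>) / fact (k - 1)"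
      using i by (simp add: clique_selection_def choice_weight_def)
  qed (use Vn in \<open>auto simp: clique_selection_def\<close>)
  then show ?thesis using Vn by (simp add: selection_term_def)
qed

section \<open>Summation over the classes of selections\<close>

lemma finite_selections: "finite (selections n E d)"
proof (rule finite_subset)
  let ?B = "{g. set g \<subseteq> (\<Union>i<n. choices E i) \<and> length g \<le> d}"
  show "selections n E d \<subseteq> {s. \<forall>i. (i \<in> {..<n} \<longrightarrow> s i \<in> ?B) \<and> (i \<notin> {..<n} \<longrightarrow> s i = [])}"
  proof
    fix s assume s: "s \<in> selections n E d"
    have "length (s i) \<le> d" if "i < n" for i
    proof -
      have "length (s i) \<le> (\<Sum>i<n. length (s i))" using that by (intro member_le_sum) auto
      then show ?thesis using s by (simp add: selections_def)
    qed
    then show "s \<in> {s. \<forall>i. (i \<in> {..<n} \<longrightarrow> s i \<in> ?B) \<and> (i \<notin> {..<n} \<longrightarrow> s i = [])}"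
      using s unfolding selections_def by auto
  qed
  show "finite {s. \<forall>i. (i \<in> {..<n} \<longrightarrow> s i \<in> ?B) \<and> (i \<notin> {..<n} \<longrightarrow> s i = [])}"
    using finite_choices[OF finite_uniform_hypergraph[OF E]]
    by (intro finite_set_of_finite_funs finite_lists_length_le) auto
qed

lemma selection_term_nonzeroD:
  assumes "selection_term k n E \<alpha> d s \<noteq> 0"
  obtains w where "w < n" "trails n (d * (k - 1)) w w (selection_arcs k s) \<noteq> 0"
proof -
  have "(\<Sum>w<n. trails n (d * (k - 1)) w w (selection_arcs k s)) \<noteq> 0"
    using assms by (auto simp: selection_term_def)
  then show ?thesis using that by (meson lessThan_iff sum.not_neutral_contains_not_neutral)
qed

lemma sum_loop_selections:
  assumes "d > 0"
  shows "(\<Sum>s\<in>loop_selection d ` {..<n}. selection_term k n E \<alpha> d s) =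
    \<alpha> ^ d * (\<Sum>i<n. real (vertex_degree E i) ^ d)"
proof -
  have "inj_on (loop_selection d) {..<n}"
  proof (rule inj_onI)
    fix u v assume "loop_selection d u = loop_selection d v"
    then have "loop_selection d v u \<noteq> []" using assms by (metis loop_selection_def length_greater_0_conv length_replicate)
    then show "u = v" by (simp add: loop_selection_def split: if_splits)
  qed
  then show ?thesis
    using assms by (simp add: sum.reindex loop_selection_term power_mult_distrib sum_distrib_left)
qed

lemma sum_selections_small:
  assumes "0 < d" "d < k"
  shows "(\<Sum>s\<in>selections n E d. selection_term k n E \<alpha> d s) =
    \<alpha> ^ d * (\<Sum>i<n. real (vertex_degree E i) ^ d)"
proof -
  have "(\<Sum>s\<in>selections n E d. selection_term k n E \<alpha> d s) =
    (\<Sum>s\<in>loop_selection d ` {..<n}. selection_term k n E \<alpha> d s)"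
  proof (rule sum.mono_neutral_right[OF finite_selections])
    show "\<forall>s\<in>selections n E d - loop_selection d ` {..<n}. selection_term k n E \<alpha> d s = 0"
    proof
      fix s assume s: "s \<in> selections n E d - loop_selection d ` {..<n}"
      show "selection_term k n E \<alpha> d s = 0"
      proof (rule ccontr)
        assume "selection_term k n E \<alpha> d s \<noteq> 0"
        then obtain w where w: "w < n" "trails n (d * (k - 1)) w w (selection_arcs k s) \<noteq> 0"
          by (rule selection_term_nonzeroD)
        then show False using selection_small[OF _ assms w] s by blast
      qed
    qed
  qed (auto intro: loop_selection_mem)
  then show ?thesis using sum_loop_selections[OF assms(1)] by simp
qed

lemma sum_selections_k:
  "(\<Sum>s\<in>selections n E k. selection_term k n E \<alpha> k s) =
    \<alpha> ^ k * (\<Sum>i<n. real (vertex_degree E i) ^ k) +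
    real (card E) * (real k ^ (k - 1) * (1 - \<alpha>) ^ k / (real k - 1) ^ (k - 1))"
proof -
  have k0: "k > 0" using k by simp
  let ?A = "loop_selection k ` {..<n}"
  let ?B = "edge_selection ` E"
  have fin: "finite ?A" "finite ?B" using finite_uniform_hypergraph[OF E] by auto
  have "(\<Sum>s\<in>selections n E k. selection_term k n E \<alpha> k s) =
      (\<Sum>s\<in>?A \<union> ?B. selection_term k n E \<alpha> k s)"
  proof (rule sum.mono_neutral_right[OF finite_selections])
    show "\<forall>s\<in>selections n E k - (?A \<union> ?B). selection_term k n E \<alpha> k s = 0"
    proof
      fix s assume s: "s \<in> selections n E k - (?A \<union> ?B)"
      show "selection_term k n E \<alpha> k s = 0"
      proof (rule ccontr)
        assume "selection_term k n E \<alpha> k s \<noteq> 0"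
        then obtain w where w: "w < n" "trails n (k * (k - 1)) w w (selection_arcs k s) \<noteq> 0"
          by (rule selection_term_nonzeroD)
        then show False using selection_k[OF _ w] s by blast
      qed
    qed
  qed (auto intro: loop_selection_mem edge_selection_mem)
  also have "\<dots> = (\<Sum>s\<in>?A. selection_term k n E \<alpha> k s) + (\<Sum>s\<in>?B. selection_term k n E \<alpha> k s)"
  proof (rule sum.union_disjoint[OF fin])
    have "loop_selection k v \<noteq> edge_selection e" if "e \<in> E" for v e
      using loop_selection_support[OF k0, of v] edge_selection_support[of e] that loop_not_edge by metis
    then show "?A \<inter> ?B = {}" by blast
  qed
  also have "(\<Sum>s\<in>?B. selection_term k n E \<alpha> k s) = (\<Sum>e\<in>E. selection_term k n E \<alpha> k (edge_selection e))"
  proof (rule sum.reindex_cong[OF _ refl refl])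
    show "inj_on edge_selection E" by (rule inj_onI) (metis edge_selection_support)
  qed
  finally show ?thesis using sum_loop_selections[OF k0] by (simp add: edge_selection_term)
qed

text \<open>The squares arise twice over: a loop at \<open>v\<close> has weight \<alpha> times the
  degree of \<open>v\<close>, and \<open>v\<close> lies in degree-many edges. The two orders cancel
  the factor 1/2.\<close>

lemma sum_edge_loop_selections:
  "(\<Sum>s\<in>(\<lambda>(e, v, b). edge_loop_selection e v b) ` (SIGMA e:E. e \<times> UNIV).
      selection_term k n E \<alpha> (k + 1) s) =
    real (k + 1) * real k ^ (k - 2) * \<alpha> * (1 - \<alpha>) ^ k / (real k - 1) ^ (k - 1) *
      (\<Sum>i<n. real (vertex_degree E i) ^ 2)"
proof -
  let ?c = "real (k + 1) * real k ^ (k - 2) * \<alpha> * (1 - \<alpha>) ^ k / (real k - 1) ^ (k - 1)"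
  have finE: "finite E" using finite_uniform_hypergraph[OF E] .
  have inj: "inj_on (\<lambda>(e, v, b). edge_loop_selection e v b) (SIGMA e:E. e \<times> (UNIV :: bool set))"
  proof (rule inj_onI)
    fix x y :: "nat set \<times> nat \<times> bool"
    assume xy: "x \<in> (SIGMA e:E. e \<times> UNIV)" "y \<in> (SIGMA e:E. e \<times> UNIV)"
      "(\<lambda>(e, v, b). edge_loop_selection e v b) x = (\<lambda>(e, v, b). edge_loop_selection e v b) y"
    obtain e v b e' v' b' where [simp]: "x = (e, v, b)" "y = (e', v', b')" by (metis prod_cases3)
    have eq: "edge_loop_selection e v b = edge_loop_selection e' v' b'" using xy by simp
    have ve: "v \<in> e" "v' \<in> e'" "e \<in> E" using xy by auto
    have e: "e = e'"
      using edge_loop_selection_support[OF ve(1), of b] edge_loop_selection_support[OF ve(2), of b'] eq by simp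
    \<comment> \<open>The vertex carrying the loop is recovered as the only one with two
      choices.\<close>
    have len: "length (edge_loop_selection e v b i) = (if i = v then 2 else of_bool (i \<in> e))" for e v b i
      by (auto simp: edge_loop_selection_def edge_selection_def)
    have "length (edge_loop_selection e v b v') = 2" unfolding eq by (simp add: len)
    then have v: "v = v'" by (auto simp: len of_bool_def split: if_splits)
    have "e \<noteq> {v}" using ve loop_not_edge by auto
    then have "b = b'"
      using fun_cong[OF eq, of v] e v by (auto simp: edge_loop_selection_def split: if_splits)
    then show "x = y" using e v by simp
  qed
  have "(\<Sum>s\<in>(\<lambda>(e, v, b). edge_loop_selection e v b) ` (SIGMA e:E. e \<times> UNIV).
      selection_term k n E \<alpha> (k + 1) s) =
    (\<Sum>(e, v, b)\<in>(SIGMA e:E. e \<times> (UNIV :: bool set)). ?c * real (vertex_degree E v) / 2)"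
  proof (rule sum.reindex_cong[OF inj refl])
    fix x :: "nat set \<times> nat \<times> bool" assume "x \<in> (SIGMA e:E. e \<times> UNIV)"
    then obtain e v b where x: "x = (e, v, b)" "e \<in> E" "v \<in> e" by auto
    show "selection_term k n E \<alpha> (k + 1) ((\<lambda>(e, v, b). edge_loop_selection e v b) x) =
        (case x of (e, v, b) \<Rightarrow> ?c * real (vertex_degree E v) / 2)"
      unfolding x(1) prod.case edge_loop_selection_term[OF x(2,3)] by simp
  qed
  also have "\<dots> = (\<Sum>e\<in>E. \<Sum>(v, b)\<in>e \<times> (UNIV :: bool set). ?c * real (vertex_degree E v) / 2)"
    using finE edgeD(3) by (subst sum.Sigma) auto
  also have "\<dots> = (\<Sum>e\<in>E. \<Sum>v\<in>e. ?c * real (vertex_degree E v))"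
    by (intro sum.cong refl) (simp add: sum.cartesian_product[symmetric] UNIV_bool)
  also have "\<dots> = (\<Sum>e\<in>E. \<Sum>v<n. if v \<in> e then ?c * real (vertex_degree E v) else 0)"
    using edgeD by (intro sum.cong refl sum.mono_neutral_cong_left) auto
  also have "\<dots> = (\<Sum>v<n. \<Sum>e\<in>E. if v \<in> e then ?c * real (vertex_degree E v) else 0)"
    by (rule sum.swap)
  also have "\<dots> = (\<Sum>v<n. ?c * real (vertex_degree E v) ^ 2)"
  proof (rule sum.cong[OF refl])
    fix v
    have "(\<Sum>e\<in>E. if v \<in> e then ?c * real (vertex_degree E v) else 0) =
      (\<Sum>e\<in>{e \<in> E. v \<in> e}. ?c * real (vertex_degree E v))"
      by (rule sum.inter_filter[OF finE, symmetric])
    then show "(\<Sum>e\<in>E. if v \<in> e then ?c * real (vertex_degree E v) else 0) =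
      ?c * real (vertex_degree E v) ^ 2"
      by (simp add: vertex_degree_def power2_eq_square)
  qed
  finally show ?thesis by (simp add: sum_distrib_left)
qed

lemma finite_clique_sets: "finite (clique_sets k n E)"
  unfolding clique_sets_def by (rule finite_subset[of _ "Pow {..<n}"]) auto

lemma sum_clique_selections:
  "(\<Sum>s\<in>(\<lambda>(V, f). clique_selection V f) ` (SIGMA V:clique_sets k n E. \<Pi>\<^sub>E i\<in>V. V - {i}).
      selection_term k n E \<alpha> (k + 1) s) =
    real (card (clique_sets k n E)) * (((1 - \<alpha>) / fact (k - 1)) ^ (k + 1) * clique_trails k (Suc k) {..k})"
proof -
  let ?P = "\<lambda>V :: nat set. \<Pi>\<^sub>E i\<in>V. V - {i}"
  have fin: "finite V" if "V \<in> clique_sets k n E" for V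
    using that finite_subset by (auto simp: clique_sets_def)
  have inj: "inj_on (\<lambda>(V, f). clique_selection V f) (SIGMA V:clique_sets k n E. ?P V)"
  proof (rule inj_onI)
    fix x y :: "nat set \<times> (nat \<Rightarrow> nat)"
    assume xy: "x \<in> (SIGMA V:clique_sets k n E. ?P V)" "y \<in> (SIGMA V:clique_sets k n E. ?P V)"
      "(\<lambda>(V, f). clique_selection V f) x = (\<lambda>(V, f). clique_selection V f) y"
    obtain V f V' f' where [simp]: "x = (V, f)" "y = (V', f')" by (metis prod.exhaust)
    have eq: "clique_selection V f i = clique_selection V' f' i" for i using xy by simp
    have V: "V = V'"
    proof (rule Set.set_eqI)
      fix i show "i \<in> V \<longleftrightarrow> i \<in> V'"
        using eq[of i] by (auto simp: clique_selection_def split: if_splits)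
    qed
    have ff: "f \<in> ?P V" "f' \<in> ?P V" using xy V by auto
    have "f = f'"
    proof (rule PiE_ext[OF ff])
      fix i assume i: "i \<in> V"
      then have "V - {f i} = V - {f' i}" using eq[of i] V by (simp add: clique_selection_def)
      moreover have "f i \<in> V" "f' i \<in> V" using ff i by auto
      ultimately show "f i = f' i" by blast
    qed
    then show "x = y" using V by simp
  qed
  have "(\<Sum>s\<in>(\<lambda>(V, f). clique_selection V f) ` (SIGMA V:clique_sets k n E. ?P V).
      selection_term k n E \<alpha> (k + 1) s) =
    (\<Sum>(V, f)\<in>(SIGMA V:clique_sets k n E. ?P V). ((1 - \<alpha>) / fact (k - 1)) ^ (k + 1) *
      (\<Sum>w<n. trails n ((k + 1) * (k - 1)) w w (selection_arcs k (clique_selection V f))))"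
    using clique_selection_term by (intro sum.reindex_cong[OF inj refl]) auto
  also have "\<dots> = (\<Sum>V\<in>clique_sets k n E. \<Sum>f\<in>?P V. ((1 - \<alpha>) / fact (k - 1)) ^ (k + 1) *
      (\<Sum>w<n. trails n ((k + 1) * (k - 1)) w w (selection_arcs k (clique_selection V f))))"
    using finite_clique_sets fin by (intro sum.Sigma[symmetric]) (auto intro!: finite_PiE)
  also have "\<dots> = (\<Sum>V\<in>clique_sets k n E. ((1 - \<alpha>) / fact (k - 1)) ^ (k + 1) * clique_trails k n V)"
    by (simp add: clique_trails_def sum_distrib_left)
  also have "\<dots> = (\<Sum>V\<in>clique_sets k n E. ((1 - \<alpha>) / fact (k - 1)) ^ (k + 1) *
      clique_trails k (Suc k) {..k})"
  proof (rule sum.cong[OF refl])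
    fix V assume "V \<in> clique_sets k n E"
    then show "((1 - \<alpha>) / fact (k - 1)) ^ (k + 1) * clique_trails k n V =
        ((1 - \<alpha>) / fact (k - 1)) ^ (k + 1) * clique_trails k (Suc k) {..k}"
      using clique_trails_invariant[OF k, of V n] by (simp add: clique_sets_def)
  qed
  finally show ?thesis by simp
qed

lemma sum_selections_Suc_k:
  "(\<Sum>s\<in>selections n E (k + 1). selection_term k n E \<alpha> (k + 1) s) =
    \<alpha> ^ (k + 1) * (\<Sum>i<n. real (vertex_degree E i) ^ (k + 1)) +
    real (k + 1) * real k ^ (k - 2) * \<alpha> * (1 - \<alpha>) ^ k / (real k - 1) ^ (k - 1) *
      (\<Sum>i<n. real (vertex_degree E i) ^ 2) +
    real (card (clique_sets k n E)) * (((1 - \<alpha>) / fact (k - 1)) ^ (k + 1) * clique_trails k (Suc k) {..k})"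
proof -
  let ?A = "loop_selection (k + 1) ` {..<n}"
  let ?C = "(\<lambda>(e, v, b). edge_loop_selection e v b) ` (SIGMA e:E. e \<times> UNIV)"
  let ?D = "(\<lambda>(V, f). clique_selection V f) ` (SIGMA V:clique_sets k n E. \<Pi>\<^sub>E i\<in>V. V - {i})"
  let ?t = "selection_term k n E \<alpha> (k + 1)"
  have sub: "?A \<union> ?C \<union> ?D \<subseteq> selections n E (k + 1)"
    using loop_selection_mem edge_loop_selection_mem clique_selection_mem by auto
  have "(\<Sum>s\<in>selections n E (k + 1). ?t s) = (\<Sum>s\<in>?A \<union> ?C \<union> ?D. ?t s)"
  proof (rule sum.mono_neutral_right[OF finite_selections sub])
    show "\<forall>s\<in>selections n E (k + 1) - (?A \<union> ?C \<union> ?D). ?t s = 0"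
    proof
      fix s assume s: "s \<in> selections n E (k + 1) - (?A \<union> ?C \<union> ?D)"
      show "?t s = 0"
      proof (rule ccontr)
        assume "?t s \<noteq> 0"
        then obtain w where w: "w < n" "trails n ((k + 1) * (k - 1)) w w (selection_arcs k s) \<noteq> 0"
          by (rule selection_term_nonzeroD)
        consider "s = loop_selection (k + 1) w"
          | e v b where "e \<in> E" "v \<in> e" "s = edge_loop_selection e v b"
          | V f where "V \<in> clique_sets k n E" "f \<in> (\<Pi>\<^sub>E i\<in>V. V - {i})" "s = clique_selection V f"
          using selection_Suc_k[OF _ w] s by blast
        then have "s \<in> ?A \<union> ?C \<union> ?D"
        proof cases
          case 1
          then show ?thesis using w(1) by blast
        next
          case 2
          then have "s \<in> ?C" by (intro image_eqI[of _ _ "(e, v, b)"]) auto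
          then show ?thesis by blast
        next
          case 3
          then have "s \<in> ?D" by (intro image_eqI[of _ _ "(V, f)"]) auto
          then show ?thesis by blast
        qed
        then show False using s by blast
      qed
    qed
  qed
  also have "\<dots> = sum ?t ?A + sum ?t ?C + sum ?t ?D"
  proof -
    have fin: "finite ?A" "finite ?C" "finite ?D"
      using sub finite_subset[OF _ finite_selections] by (meson le_sup_iff)+
    \<comment> \<open>The three classes are told apart by the sizes 1, k and k + 1 of their
      supports, distinct because k \<ge> 2.\<close>
    let ?n = "\<lambda>s :: nat \<Rightarrow> nat set list. card {i. s i \<noteq> []}"
    have A: "?n s = 1" if "s \<in> ?A" for s
      using that loop_selection_support[of "k + 1"] by auto
    have C: "?n s = k" if "s \<in> ?C" for s
      using that edge_loop_selection_support edgeD(2) by auto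
    have D: "?n s = Suc k" if "s \<in> ?D" for s
    proof -
      have "{i. clique_selection V f i \<noteq> []} = V" for V f by (auto simp: clique_selection_def)
      then show ?thesis using that by (auto simp: clique_sets_def)
    qed
    have "?A \<inter> ?C = {}"
    proof (rule equals0I)
      fix s assume s: "s \<in> ?A \<inter> ?C"
      show False using A[OF IntD1[OF s]] C[OF IntD2[OF s]] k by linarith
    qed
    moreover have "(?A \<union> ?C) \<inter> ?D = {}"
    proof (rule equals0I)
      fix s assume s: "s \<in> (?A \<union> ?C) \<inter> ?D"
      from IntD1[OF s] have "?n s = 1 \<or> ?n s = k" by (rule UnE) (simp_all only: A C simp_thms)
      then show False using D[OF IntD2[OF s]] k by linarith
    qed
    ultimately show ?thesis using fin by (simp only: sum.union_disjoint finite_UnI)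
  qed
  finally show ?thesis
    unfolding sum_edge_loop_selections sum_clique_selections by (simp add: sum_loop_selections)
qed

text \<open>A complete subhypergraph with k + 1 edges has k + 1 vertices: on fewer vertices there is
  at most one k-subset, and on k + 2 or more there are more than k + 1 of them. Its vertex set then
  determines it.\<close>

lemma card_clique_sets: "card (complete_subhypergraphs_Suc k n E) = card (clique_sets k n E)"
proof -
  let ?h = "\<lambda>V. (V, {e. e \<subseteq> V \<and> card e = k})"
  have binom: "card V = Suc k" if "card V choose k = Suc k" for V :: "nat set"
  proof (rule ccontr)
    assume ne: "card V \<noteq> Suc k"
    consider "card V < k" | "card V = k" | "card V \<ge> Suc (Suc k)" using ne by linarith
    then show False
    proof cases
      case 3
      then have "(Suc (Suc k) choose k) \<le> (card V choose k)" by (rule binomial_right_mono)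
      moreover have "(Suc (Suc k) choose k) = (Suc k choose k) + (Suc k choose (k - 1))"
        using k by (cases k) auto
      moreover have "(Suc k choose (k - 1)) > 0" by simp
      ultimately show False using that by simp
    qed (use that k in \<open>auto simp: binomial_eq_0\<close>)
  qed
  have "complete_subhypergraphs_Suc k n E = ?h ` clique_sets k n E"
  proof (intro equalityI subsetI)
    fix x assume "x \<in> complete_subhypergraphs_Suc k n E"
    then obtain V E' where x: "x = (V, E')" "V \<subseteq> {..<n}" "E' \<subseteq> E" "E' = {e. e \<subseteq> V \<and> card e = k}" "card E' = k + 1"
      by (auto simp: complete_subhypergraphs_Suc_def complete_subhypergraphs_def)
    have "finite V" using x(2) finite_subset by blast
    then have "card V choose k = Suc k" using n_subsets[of V k] x(4,5) by simp
    then show "x \<in> ?h ` clique_sets k n E" using x binom by (auto simp: clique_sets_def)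
  next
    fix x assume "x \<in> ?h ` clique_sets k n E"
    then obtain V where V: "x = ?h V" "V \<subseteq> {..<n}" "card V = Suc k"
      "\<And>e. e \<subseteq> V \<Longrightarrow> card e = k \<Longrightarrow> e \<in> E" by (auto simp: clique_sets_def)
    have "finite V" using V(2) finite_subset by blast
    then have "card {e. e \<subseteq> V \<and> card e = k} = k + 1" using n_subsets[of V k] V(3) by simp
    then show "x \<in> complete_subhypergraphs_Suc k n E"
      using V by (auto simp: complete_subhypergraphs_Suc_def complete_subhypergraphs_def)
  qed
  then show ?thesis by (simp add: card_image inj_on_def)
qed

text \<open>The exponent n - k may be negative, hence the integer power; \<open>n > 0\<close>
  ensures that \<open>n - 1\<close> is not truncated.\<close>

lemma power_int_diff_eq:
  assumes "n > 0"
  shows "(real k - 1) powi (int n - int k) = (real k - 1) ^ (n - 1) / (real k - 1) ^ (k - 1)"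
proof -
  have "int n - int k = int (n - 1) - int (k - 1)" using assms k by simp
  moreover have "real k - 1 \<noteq> 0" using k by simp
  ultimately show ?thesis by (simp only: power_int_diff power_int_of_nat simp_thms)
qed

end

theorem corollary3p2:
  fixes k :: nat
  assumes "k \<ge> 2"
  shows "\<exists>C :: real. \<forall>(n :: nat) (E :: nat set set) (\<alpha> :: real).
    uniform_hypergraph k n E \<longrightarrow> 0 \<le> \<alpha> \<longrightarrow> \<alpha> \<le> 1 \<longrightarrow>
    (let \<phi> = (\<lambda>s :: nat. (real k - 1) ^ (n - 1) * \<alpha> ^ s * (\<Sum>i<n. real (vertex_degree E i) ^ s))
     in
       (\<forall>d\<in>{1..k - 1}. tensor_trace k n d (A_alpha_tensor k E \<alpha>) = \<phi> d) \<and>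
       tensor_trace k n k (A_alpha_tensor k E \<alpha>) =
         \<phi> k + (real k - 1) powi (int n - int k) * real k ^ (k - 1) * (1 - \<alpha>) ^ k * real (card E) \<and>
       tensor_trace k n (k + 1) (A_alpha_tensor k E \<alpha>) =
         \<phi> (k + 1) + real (k + 1) * (real k - 1) powi (int n - int k) *
           (real k ^ (k - 2) * \<alpha> * (1 - \<alpha>) ^ k * (\<Sum>i<n. real (vertex_degree E i) ^ 2) +
            (1 - \<alpha>) ^ (k + 1) * C * real (card (complete_subhypergraphs_Suc k n E))))"
proof -
  \<comment> \<open>\<open>G\<close> is the clique contribution per clique without its power of 1 -
    \<alpha>. The rescaling in \<open>C\<close> offsets the prefactor (k + 1) (k - 1)^(n - k) of the
    claim against the (k - 1)^(n - 1) of the trace.\<close>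
  define G where "G = clique_trails k (Suc k) {..k} / fact (k - 1) ^ (k + 1)"
  define C where "C = G * (real k - 1) ^ (k - 1) / real (k + 1)"
  show ?thesis
    unfolding Let_def
  proof (intro exI[of _ C] allI impI conjI ballI)
    fix n E \<alpha>
    assume E: "uniform_hypergraph k n E"
    interpret uniform_hypergraph_on k n E by unfold_locales fact+
    note trace = tensor_trace_selections[OF assms E, of _ \<alpha>]
    show "tensor_trace k n d (A_alpha_tensor k E \<alpha>) =
        (real k - 1) ^ (n - 1) * \<alpha> ^ d * (\<Sum>i<n. real (vertex_degree E i) ^ d)" if "d \<in> {1..k - 1}" for d
    proof -
      have "0 < d" "d < k" using that assms by auto
      then show ?thesis unfolding trace by (simp add: sum_selections_small)
    qed
    let ?P = "(real k - 1) powi (int n - int k)"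
    let ?Q = "(real k - 1) ^ (n - 1) / (real k - 1) ^ (k - 1)"
    have PQ: "?P = ?Q" if "n > 0" using power_int_diff_eq[OF that] .
    \<comment> \<open>For \<open>n = 0\<close> the truncated \<open>n - 1\<close> breaks the
      identity for the powers, but there are no edges, cliques or degrees, so the terms concerned
      vanish.\<close>
    have n0: "card E = 0" "card (clique_sets k n E) = 0" if "n = 0"
    proof -
      have "E = {}" using edgeD assms that by fastforce
      then show "card E = 0" by simp
      have "clique_sets k n E = {}" using that by (auto simp: clique_sets_def)
      then show "card (clique_sets k n E) = 0" by simp
    qed
    show "tensor_trace k n k (A_alpha_tensor k E \<alpha>) =
        (real k - 1) ^ (n - 1) * \<alpha> ^ k * (\<Sum>i<n. real (vertex_degree E i) ^ k) +
        ?P * real k ^ (k - 1) * (1 - \<alpha>) ^ k * real (card E)"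
      unfolding trace sum_selections_k
      using PQ n0(1) by (cases "n = 0") (simp_all add: algebra_simps)
    let ?N = "real (card (clique_sets k n E))"
    let ?S = "\<Sum>i<n. real (vertex_degree E i) ^ 2"
    have G: "((1 - \<alpha>) / fact (k - 1)) ^ (k + 1) * clique_trails k (Suc k) {..k} = (1 - \<alpha>) ^ (k + 1) * G"
      by (simp add: G_def power_divide)
    have "(real k - 1) ^ (n - 1) * (real (k + 1) * real k ^ (k - 2) * \<alpha> * (1 - \<alpha>) ^ k / (real k - 1) ^ (k - 1) * ?S)
       = real (k + 1) * ?P * (real k ^ (k - 2) * \<alpha> * (1 - \<alpha>) ^ k * ?S)"
      using PQ by (cases "n = 0") simp_all
    moreover have "(real k - 1) ^ (n - 1) * (?N * ((1 - \<alpha>) ^ (k + 1) * G)) =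
        real (k + 1) * ?P * ((1 - \<alpha>) ^ (k + 1) * C * ?N)"
    proof (cases "n = 0")
      case True
      show ?thesis using n0(2)[OF True] by simp
    next
      case False
      have "(real k - 1) ^ (k - 1) \<noteq> 0" using assms by simp
      then show ?thesis using False unfolding C_def by (simp add: PQ)
    qed
    ultimately show "tensor_trace k n (k + 1) (A_alpha_tensor k E \<alpha>) =
        (real k - 1) ^ (n - 1) * \<alpha> ^ (k + 1) * (\<Sum>i<n. real (vertex_degree E i) ^ (k + 1)) +
        real (k + 1) * ?P * (real k ^ (k - 2) * \<alpha> * (1 - \<alpha>) ^ k * ?S +
          (1 - \<alpha>) ^ (k + 1) * C * real (card (complete_subhypergraphs_Suc k n E)))"
      unfolding trace sum_selections_Suc_k card_clique_sets G by (simp only: distrib_left mult.assoc)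
  qed
qed

end
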